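(* Let $0<r_1<r_2$, $N\ge 2$, and let $h:[r_1,r_2]\times[0,\infty)\to[0,\infty)$ be continuous with $h(t,0)=0$. Let $q$ and $f$ be defined from $h$ as in the context, and consider, for $\lambda>0$, the boundary value problem $$u''(t)+\lambda q(t)f(t,u(t))=0,\quad t\in(0,1),\qquad u(0)=0=u(1). \qquad (P_\lambda)$$ Assume there exist a continuous function $b:[0,1]\to[0,\infty)$, not identically zero, and positive constants $c,\delta,R$ with $c>1$ and $0<\delta<R$ such that (i) $f(t,u)\le b(t)u$ for all $u\ge R$, uniformly in $t\in(0,1)$, and (ii) $f(t,u)\ge c\,b(t)u$ for all $u\in(0,\delta)$, uniformly in $t\in(0,1)$. Then $(P_\lambda)$ has a positive solution for every $\lambda$ with $\frac{\lambda_{1,qb}}{c}<\lambda<\lambda_{1,qb}$.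
   Context: The problem $(P_\lambda)$ arises from radial solutions of $-\Delta v=\lambda h(|x|,v)$ in the annulus $\{x\in\mathbb{R}^N: r_1<|x|<r_2\}$, $v=0$ on the boundary. The functions $q$ and $f$ are defined as follows. If $N=2$: $q(t)=\left[r_2\left(\frac{r_1}{r_2}\right)^t\log\frac{r_2}{r_1}\right]^2$ and $f(t,u)=h\!\left(r_2\left(\frac{r_1}{r_2}\right)^t,u\right)$. If $N\ge 3$: with $A=\frac{(r_1r_2)^{N-2}}{r_2^{N-2}-r_1^{N-2}}$ and $B=\frac{r_2^{N-2}}{r_2^{N-2}-r_1^{N-2}}$, $q(t)=(N-2)^{-2}\frac{A^{2/(N-2)}}{(B-t)^{2(N-1)/(N-2)}}$ and $f(t,u)=h\!\left(\left(\frac{A}{B-t}\right)^{1/(N-2)},u\right)$. In either case $q$ is continuous on $[0,1]$ and bounded between positive constants there. A positive solution of $(P_\lambda)$ is a function $u\in C([0,1])\cap C^2(0,1)$ satisfying $(P_\lambda)$ with $u(t)>0$ for $t\in(0,1)$. For a continuous $m:[0,1]\to[0,\infty)$ that is positive on a set of positive measure, $\lambda_{1,m}$ denotes the first (smallest) eigenvalue of $-u''=\lambda m(t)u$ on $(0,1)$, $u(0)=u(1)=0$; its eigenfunction $\phi_{1,m}$ satisfies $\phi_{1,m}>0$ on $(0,1)$. Here $\lambda_{1,qb}$ is this eigenvalue with $m=qb$. *)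

theory Defs
  imports "HOL-Analysis.Analysis"
begin

definition C2_open01 :: "(real \<Rightarrow> real) \<Rightarrow> (real \<Rightarrow> real) \<Rightarrow> bool" where
  "C2_open01 u u2 \<longleftrightarrow> (\<exists>u1. (\<forall>t\<in>{0<..<1}. (u has_real_derivative u1 t) (at t)
        \<and> (u1 has_real_derivative u2 t) (at t)) \<and> continuous_on {0<..<1} u2)"

definition dirichlet_eigen :: "(real \<Rightarrow> real) \<Rightarrow> real \<Rightarrow> (real \<Rightarrow> real) \<Rightarrow> bool" where
  "dirichlet_eigen m lam u \<longleftrightarrow> continuous_on {0..1} u \<and> u 0 = 0 \<and> u 1 = 0
     \<and> (\<exists>t\<in>{0<..<1}. u t \<noteq> 0)
     \<and> (\<exists>u2. C2_open01 u u2 \<and> (\<forall>t\<in>{0<..<1}. - u2 t = lam * m t * u t))"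

definition lambda1 :: "(real \<Rightarrow> real) \<Rightarrow> real" where
  "lambda1 m = (LEAST lam. \<exists>u. dirichlet_eigen m lam u)"

definition qfun :: "nat \<Rightarrow> real \<Rightarrow> real \<Rightarrow> real \<Rightarrow> real" where
  "qfun N r1 r2 t =
     (if N = 2 then (r2 * (r1 / r2) powr t * ln (r2 / r1))\<^sup>2
      else (let A = (r1 * r2) ^ (N - 2) / (r2 ^ (N - 2) - r1 ^ (N - 2));
                B = r2 ^ (N - 2) / (r2 ^ (N - 2) - r1 ^ (N - 2))
            in (1 / (real N - 2)\<^sup>2) * A powr (2 / (real N - 2))
                 / (B - t) powr (2 * (real N - 1) / (real N - 2))))"

definition ffun :: "nat \<Rightarrow> real \<Rightarrow> real \<Rightarrow> (real \<Rightarrow> real \<Rightarrow> real) \<Rightarrow> real \<Rightarrow> real \<Rightarrow> real" where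
  "ffun N r1 r2 h t u =
     (if N = 2 then h (r2 * (r1 / r2) powr t) u
      else (let A = (r1 * r2) ^ (N - 2) / (r2 ^ (N - 2) - r1 ^ (N - 2));
                B = r2 ^ (N - 2) / (r2 ^ (N - 2) - r1 ^ (N - 2))
            in h ((A / (B - t)) powr (1 / (real N - 2))) u))"

definition positive_solution :: "nat \<Rightarrow> real \<Rightarrow> real \<Rightarrow> (real \<Rightarrow> real \<Rightarrow> real) \<Rightarrow> real \<Rightarrow> (real \<Rightarrow> real) \<Rightarrow> bool" where
  "positive_solution N r1 r2 h lam u \<longleftrightarrow> continuous_on {0..1} u \<and> u 0 = 0 \<and> u 1 = 0
     \<and> (\<forall>t\<in>{0<..<1}. u t > 0)
     \<and> (\<exists>u2. C2_open01 u u2 \<and>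
          (\<forall>t\<in>{0<..<1}. u2 t + lam * qfun N r1 r2 t * ffun N r1 r2 h t (u t) = 0))"

end

theory Submission
  imports Defs "HOL-Complex_Analysis.Great_Picard"
begin

text \<open>
  Put \<open>m = q b\<close>. The solution \<open>y(\<lambda>, \<cdot>)\<close> of \<open>y'' + \<lambda> m y = 0\<close>, \<open>y(0) = 0\<close>, \<open>y'(0) = 1\<close> is a power
  series in \<open>\<lambda>\<close>, and the first eigenvalue is the least \<open>\<Lambda>\<close> for which \<open>y(\<Lambda>, \<cdot>)\<close> has a zero in
  \<open>(0, 1]\<close>; its eigenfunction \<open>\<phi> = y(\<Lambda>, \<cdot>)\<close> is positive. For \<open>\<lambda> < \<Lambda>\<close> the positivity of
  \<open>y(\<lambda>, \<cdot>)\<close> yields a function \<open>\<psi> > 0\<close> on \<open>[0, 1]\<close> with \<open>- \<psi>'' = \<lambda> m \<psi> + 1\<close>.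

  By the growth condition at infinity \<open>f(t, u) \<le> b(t) u + M\<close>, so a large multiple of \<open>\<psi>\<close> is a
  supersolution of the nonlinear problem; by the condition near zero and \<open>\<lambda> c > \<Lambda>\<close>, a small multiple
  of \<open>\<phi>\<close> is a subsolution. A solution between them is obtained by truncating the nonlinearity.
  The truncated problem has a bounded continuous right-hand side and is solved by shooting in the
  initial slope (with a delayed argument, to have continuous dependence) and Arzela--Ascoli.
\<close>

subsection \<open>The Volterra operator of the second derivative\<close>

text \<open>The double antiderivative of \<open>g\<close> with value and slope 0 at 0. Writing the
  kernel as \<open>max 0 (t - \<tau>)\<close> keeps the domain of integration fixed, so that
  continuity in parameters and dominated convergence apply without a moving endpoint.\<close>

definition volterra :: "(real \<Rightarrow> real) \<Rightarrow> real \<Rightarrow> real" where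
  "volterra g t = integral {0..1} (\<lambda>\<tau>. max 0 (t - \<tau>) * g \<tau>)"

lemma volterra_eq:
  assumes g: "continuous_on {0..1} g" and t: "t \<in> {0..1}"
  shows "volterra g t = integral {0..t} (\<lambda>\<tau>. (t - \<tau>) * g \<tau>)"
proof -
  let ?k = "\<lambda>\<tau>. max 0 (t - \<tau>) * g \<tau>"
  have "continuous_on {0..1} ?k"
    by (intro continuous_intros g)
  hence "integral {0..t} ?k + integral {t..1} ?k = integral {0..1} ?k"
    using t by (intro Henstock_Kurzweil_Integration.integral_combine integrable_continuous_interval) auto
  moreover have "integral {t..1} ?k = integral {t..1} (\<lambda>_. 0)"
    by (rule integral_cong) (simp add: max_def)
  moreover have "integral {0..t} ?k = integral {0..t} (\<lambda>\<tau>. (t - \<tau>) * g \<tau>)"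
    by (rule integral_cong) simp
  ultimately show ?thesis
    by (simp add: volterra_def)
qed

lemma volterra_0 [simp]: "volterra g 0 = 0"
proof -
  have "volterra g 0 = integral {0..1::real} (\<lambda>_. 0)"
    unfolding volterra_def by (rule integral_cong) simp
  thus ?thesis by simp
qed

text \<open>The kernel and the length of the interval are each at most \<open>t\<close>. The
  quadratic order lets the linear term of an initial value problem win near 0; at
  \<open>t = 1\<close> the bound controls the shooting map.\<close>

lemma volterra_bound:
  assumes g: "continuous_on {0..1} g" and t: "t \<in> {0..1}"
    and C: "\<And>\<tau>. \<tau> \<in> {0..1} \<Longrightarrow> \<bar>g \<tau>\<bar> \<le> C"
  shows "\<bar>volterra g t\<bar> \<le> C * t\<^sup>2"
proof -
  have "norm (integral {0..t} (\<lambda>\<tau>. (t - \<tau>) * g \<tau>)) \<le> (t * C) * (t - 0)"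
  proof (rule integral_bound)
    show "continuous_on {0..t} (\<lambda>\<tau>. (t - \<tau>) * g \<tau>)"
      using t by (intro continuous_intros continuous_on_subset[OF g]) auto
    fix \<tau> assume "\<tau> \<in> {0..t}"
    thus "norm ((t - \<tau>) * g \<tau>) \<le> t * C"
      using t C[of \<tau>] by (auto simp: abs_mult intro!: mult_mono)
  qed (use t in auto)
  thus ?thesis
    using volterra_eq[OF g t] by (simp add: power2_eq_square mult_ac)
qed

text \<open>The kernel is 1-Lipschitz in \<open>t\<close>. This provides the equicontinuity for
  Arzela-Ascoli.\<close>

lemma volterra_lipschitz:
  assumes g: "continuous_on {0..1} g" and C: "\<And>\<tau>. \<tau> \<in> {0..1} \<Longrightarrow> \<bar>g \<tau>\<bar> \<le> C"
  shows "\<bar>volterra g t - volterra g t'\<bar> \<le> C * \<bar>t - t'\<bar>"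
proof -
  let ?k = "\<lambda>t \<tau>. max 0 (t - \<tau>) * g \<tau>"
  have k: "continuous_on {0..1} (?k t)" for t
    by (intro continuous_intros g)
  have "volterra g t - volterra g t' = integral {0..1} (\<lambda>\<tau>. ?k t \<tau> - ?k t' \<tau>)"
    unfolding volterra_def
    by (intro integral_diff[symmetric] integrable_continuous_interval k)
  also have "norm \<dots> \<le> (\<bar>t - t'\<bar> * C) * (1 - 0)"
  proof (rule integral_bound)
    fix \<tau> :: real assume "\<tau> \<in> {0..1}"
    have "norm (?k t \<tau> - ?k t' \<tau>) = \<bar>max 0 (t - \<tau>) - max 0 (t' - \<tau>)\<bar> * \<bar>g \<tau>\<bar>"
      by (simp add: abs_mult[symmetric] left_diff_distrib)
    also have "\<dots> \<le> \<bar>t - t'\<bar> * C"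
      using C[OF \<open>\<tau> \<in> {0..1}\<close>] by (intro mult_mono) auto
    finally show "norm (?k t \<tau> - ?k t' \<tau>) \<le> \<bar>t - t'\<bar> * C" .
  qed (auto intro!: continuous_intros k)
  finally show ?thesis by (simp add: mult_ac)
qed

lemma continuous_on_volterra_param:
  fixes g :: "'a::topological_space \<Rightarrow> real \<Rightarrow> real"
  assumes g: "continuous_on (S \<times> {0..1}) (\<lambda>(s, t). g s t)"
  shows "continuous_on (S \<times> T) (\<lambda>(s, t). volterra (g s) t)"
proof -
  have "continuous_on ((S \<times> T) \<times> {0..1}) (\<lambda>z. (\<lambda>(s, t). g s t) (fst (fst z), snd z))"
    by (rule continuous_on_compose2[OF g]) (auto intro!: continuous_intros)
  hence "continuous_on ((S \<times> T) \<times> cbox 0 1)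
      (\<lambda>(p, \<tau>). max 0 (snd p - \<tau>) * g (fst p) \<tau>)"
    by (auto simp: case_prod_unfold intro!: continuous_intros)
  from integral_continuous_on_param[OF this] show ?thesis
    by (simp add: volterra_def case_prod_unfold)
qed

lemma continuous_on_volterra:
  assumes "continuous_on {0..1} g"
  shows "continuous_on T (volterra g)"
proof -
  have "continuous_on (UNIV \<times> {0..1}) (\<lambda>(s::real, t). g t)"
    unfolding case_prod_unfold
    by (rule continuous_on_compose2[OF assms]) (auto intro!: continuous_intros)
  hence *: "continuous_on (UNIV \<times> T) (\<lambda>(s::real, t). volterra g t)"
    by (rule continuous_on_volterra_param)
  have "continuous_on T (\<lambda>t. (\<lambda>(s::real, t). volterra g t) (0, t))"
    by (rule continuous_on_compose2[OF *]) (auto intro!: continuous_intros)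
  thus ?thesis by simp
qed

lemma has_real_derivative_integral_open:
  fixes g :: "real \<Rightarrow> real"
  assumes g: "continuous_on {0..1} g" and t: "t \<in> {0<..<1}"
  shows "((\<lambda>t. integral {0..t} g) has_real_derivative g t) (at t)"
  using integral_has_real_derivative[OF g, of t] t at_within_Icc_at[of 0 t 1] by simp

lemma has_real_derivative_volterra:
  assumes g: "continuous_on {0..1} g" and t: "t \<in> {0<..<1}"
  shows "(volterra g has_real_derivative integral {0..t} g) (at t)"
proof (rule has_field_derivative_transform_within_open)
  have g': "continuous_on {0..1} (\<lambda>\<tau>. \<tau> * g \<tau>)"
    by (intro continuous_intros g)
  \<comment> \<open>Splitting the kernel avoids differentiating under the integral sign; in the
    product rule the two terms \<open>t * g t\<close> cancel.\<close>
  show "((\<lambda>t. t * integral {0..t} g - integral {0..t} (\<lambda>\<tau>. \<tau> * g \<tau>))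
      has_real_derivative integral {0..t} g) (at t)"
    by (rule derivative_eq_intros has_real_derivative_integral_open g g' t refl)+ simp
  fix x :: real assume x: "x \<in> {0<..<1}"
  have gx: "continuous_on {0..x} g"
    using x by (intro continuous_on_subset[OF g]) auto
  have "volterra g x = integral {0..x} (\<lambda>\<tau>. x * g \<tau> - \<tau> * g \<tau>)"
    using x by (simp add: volterra_eq[OF g] left_diff_distrib)
  also have "\<dots> = integral {0..x} (\<lambda>\<tau>. x * g \<tau>) - integral {0..x} (\<lambda>\<tau>. \<tau> * g \<tau>)"
    by (intro integral_diff integrable_continuous_interval continuous_intros gx)
  finally show "x * integral {0..x} g - integral {0..x} (\<lambda>\<tau>. \<tau> * g \<tau>) = volterra g x"
    by simp
qed (use t in auto)

text \<open>For \<open>t \<le> 1\<close> the kernel is at most 1, so the constant \<open>C\<close>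
  dominates and pointwise limits suffice.\<close>

lemma volterra_tendsto:
  assumes "\<And>n. continuous_on {0..1} (g n)"
    and "\<And>n \<tau>. \<tau> \<in> {0..1} \<Longrightarrow> \<bar>g n \<tau>\<bar> \<le> C"
    and lim: "\<And>\<tau>. \<tau> \<in> {0..1} \<Longrightarrow> (\<lambda>n. g n \<tau>) \<longlonglongrightarrow> g' \<tau>"
    and t: "t \<in> {0..1}"
  shows "(\<lambda>n. volterra (g n) t) \<longlonglongrightarrow> volterra g' t"
  unfolding volterra_def
proof (rule dominated_convergence(2)[where h = "\<lambda>_. C"])
  show "(\<lambda>\<tau>. max 0 (t - \<tau>) * g n \<tau>) integrable_on {0..1}" for n
    by (intro integrable_continuous_interval continuous_intros assms)
  fix n and \<tau> :: real assume "\<tau> \<in> {0..1}"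
  thus "norm (max 0 (t - \<tau>) * g n \<tau>) \<le> C"
    using t assms(2)[of \<tau> n] mult_mono[of "max 0 (t - \<tau>)" 1 "\<bar>g n \<tau>\<bar>" C] by (simp add: abs_mult)
qed (auto intro!: tendsto_intros lim)

subsection \<open>Boundary value problems with bounded right-hand side\<close>

text \<open>Tonelli's device: with a delay \<open>d\<close> in the right-hand side the iteration below becomes
  stationary on \<open>[0, k d]\<close> after \<open>k\<close> steps, so a solution depending continuously on the slope \<open>s\<close>
  is obtained without any Lipschitz condition.\<close>

fun delayed_iter :: "(real \<Rightarrow> real \<Rightarrow> real) \<Rightarrow> real \<Rightarrow> nat \<Rightarrow> real \<Rightarrow> real \<Rightarrow> real" where
  "delayed_iter F d 0 s t = 0"
| "delayed_iter F d (Suc k) s t =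
     s * t - volterra (\<lambda>\<tau>. F \<tau> (delayed_iter F d k s (max 0 (\<tau> - d)))) t"

lemma continuous_on_delayed:
  fixes F :: "real \<Rightarrow> real \<Rightarrow> real"
  assumes F: "continuous_on ({0..1} \<times> UNIV) (\<lambda>(t, x). F t x)"
    and v: "continuous_on (S \<times> {0..1}) (\<lambda>(s, t). v s t)" and d: "d \<ge> 0"
  shows "continuous_on (S \<times> {0..1}) (\<lambda>(s, \<tau>). F \<tau> (v s (max 0 (\<tau> - d))))"
proof -
  have "continuous_on (S \<times> {0..1}) (\<lambda>z. (\<lambda>(s, t). v s t) (fst z, max 0 (snd z - d)))"
    using d by (intro continuous_on_compose2[OF v]) (auto intro!: continuous_intros)
  hence "continuous_on (S \<times> {0..1})
      (\<lambda>z. (\<lambda>(t, x). F t x) (snd z, v (fst z) (max 0 (snd z - d))))"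
    by (intro continuous_on_compose2[OF F]) (auto intro!: continuous_intros)
  thus ?thesis by (simp add: case_prod_unfold)
qed

lemma continuous_on_delayed_iter:
  assumes F: "continuous_on ({0..1} \<times> UNIV) (\<lambda>(t, x). F t x)" and d: "d \<ge> 0"
  shows "continuous_on (UNIV \<times> {0..1}) (\<lambda>(s, t). delayed_iter F d k s t)"
proof (induction k)
  case (Suc k)
  from continuous_on_volterra_param[OF continuous_on_delayed[OF F Suc d], of "{0..1}"]
  show ?case
    by (auto simp: case_prod_unfold intro!: continuous_intros)
qed (simp add: case_prod_unfold)

text \<open>For \<open>\<tau> \<le> t \<le> (k + 1) * d\<close> the delayed argument is at most
  \<open>k * d\<close>, where the iterates already agree; for \<open>\<tau> > t\<close> the kernel
  vanishes. In the base case only \<open>t = 0\<close> remains.\<close>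

lemma delayed_iter_stationary:
  assumes d: "d > 0"
  shows "t \<in> {0..1} \<Longrightarrow> t \<le> real k * d \<Longrightarrow> delayed_iter F d (Suc k) s t = delayed_iter F d k s t"
proof (induction k arbitrary: t)
  case (Suc k)
  have "volterra (\<lambda>\<tau>. F \<tau> (delayed_iter F d (Suc k) s (max 0 (\<tau> - d)))) t
      = volterra (\<lambda>\<tau>. F \<tau> (delayed_iter F d k s (max 0 (\<tau> - d)))) t"
    unfolding volterra_def
  proof (rule integral_cong)
    fix \<tau> :: real assume \<tau>: "\<tau> \<in> {0..1}"
    show "max 0 (t - \<tau>) * F \<tau> (delayed_iter F d (Suc k) s (max 0 (\<tau> - d)))
        = max 0 (t - \<tau>) * F \<tau> (delayed_iter F d k s (max 0 (\<tau> - d)))"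
    proof (cases "\<tau> \<le> t")
      case True
      hence "max 0 (\<tau> - d) \<in> {0..1}" "max 0 (\<tau> - d) \<le> real k * d"
        using Suc.prems \<tau> d by (auto simp: algebra_simps)
      from Suc.IH[OF this] show ?thesis by presburger
    qed simp
  qed
  thus ?case by (simp only: delayed_iter.simps(2))
qed simp

text \<open>Shooting: the value at 1 differs from the slope \<open>s\<close> by at most
  \<open>C\<close>, so it is nonnegative for \<open>s = C\<close> and nonpositive for
  \<open>s = - C\<close>, and some slope in between hits 0.\<close>

lemma delayed_problem_solution:
  assumes F: "continuous_on ({0..1} \<times> UNIV) (\<lambda>(t, x). F t x)"
    and C: "\<And>t x. t \<in> {0..1} \<Longrightarrow> \<bar>F t x\<bar> \<le> C"
  obtains s u where "\<bar>s\<bar> \<le> C" "continuous_on {0..1} u" "u 1 = 0"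
    "\<And>t. t \<in> {0..1} \<Longrightarrow>
      u t = s * t - volterra (\<lambda>\<tau>. F \<tau> (u (max 0 (\<tau> - 1 / real (Suc n))))) t"
proof -
  \<comment> \<open>With this delay, \<open>n + 1\<close> steps cover \<open>[0, 1]\<close>, so
    iterate number \<open>n + 1\<close> is already a fixed point on the whole interval.\<close>
  define d where "d = 1 / real (Suc n)"
  define v where "v = delayed_iter F d (Suc n)"
  have d: "d > 0" "real (Suc n) * d = 1" by (auto simp: d_def)
  have cont: "continuous_on (UNIV \<times> {0..1}) (\<lambda>(s, t). v s t)"
    unfolding v_def using F d by (intro continuous_on_delayed_iter) auto
  have cont_t: "continuous_on {0..1} (v s)" for s
  proof -
    have "continuous_on {0..1} (\<lambda>t. (\<lambda>(s, t). v s t) (s, t))"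
      by (rule continuous_on_compose2[OF cont]) (auto intro!: continuous_intros)
    thus ?thesis by simp
  qed
  have eq: "v s t = s * t - volterra (\<lambda>\<tau>. F \<tau> (v s (max 0 (\<tau> - d)))) t" if "t \<in> {0..1}" for s t
    using delayed_iter_stationary[OF d(1) that, of "Suc n" F s] that d
    by (simp add: v_def)
  have cont_F: "continuous_on {0..1} (\<lambda>\<tau>. F \<tau> (v s (max 0 (\<tau> - d))))" for s
  proof -
    have "continuous_on {0..1} (\<lambda>t. (\<lambda>(s, \<tau>). F \<tau> (v s (max 0 (\<tau> - d)))) (s, t))"
      using d by (intro continuous_on_compose2[OF continuous_on_delayed[OF F cont]])
        (auto intro!: continuous_intros)
    thus ?thesis by simp
  qed
  have bound: "\<bar>v s 1 - s\<bar> \<le> C" for s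
    using volterra_bound[OF cont_F[of s], of 1 C] d eq[of 1 s] C by auto
  have "C \<ge> 0" using C[of 0 0] by auto
  have "\<exists>s. - C \<le> s \<and> s \<le> C \<and> v s 1 = 0"
  proof (rule IVT')
    show "continuous_on {- C..C} (\<lambda>s. v s 1)"
    proof -
      have "continuous_on {- C..C} (\<lambda>s. (\<lambda>(s, t). v s t) (s, 1))"
        by (rule continuous_on_compose2[OF cont]) (auto intro!: continuous_intros)
      thus ?thesis by simp
    qed
  qed (use bound[of C] bound[of "- C"] \<open>C \<ge> 0\<close> in auto)
  then obtain s where "- C \<le> s" "s \<le> C" "v s 1 = 0" by blast
  with that[of s "v s"] cont_t eq show ?thesis by (auto simp: d_def)
qed

text \<open>The delay tends to 0. The delayed solutions share a Lipschitz constant and vanish at 1,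
  so a subsequence converges uniformly, and its limit solves the undelayed equation.\<close>

theorem bounded_bvp_solution:
  assumes F: "continuous_on ({0..1} \<times> UNIV) (\<lambda>(t, x). F t x)"
    and C: "\<And>t x. t \<in> {0..1} \<Longrightarrow> \<bar>F t x\<bar> \<le> C"
  obtains s u where "continuous_on {0..1} u" "u 0 = 0" "u 1 = 0"
    "\<And>t. t \<in> {0..1} \<Longrightarrow> u t = s * t - volterra (\<lambda>\<tau>. F \<tau> (u \<tau>)) t"
proof -
  define d where "d n = 1 / real (Suc n)" for n
  have d: "d n > 0" "d n \<le> 1" for n by (auto simp: d_def)
  have "\<exists>s u. \<bar>s\<bar> \<le> C \<and> continuous_on {0..1} u \<and> u 1 = 0 \<and>
      (\<forall>t\<in>{0..1}. u t = s * t - volterra (\<lambda>\<tau>. F \<tau> (u (max 0 (\<tau> - d n)))) t)" for n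
    unfolding d_def by (rule delayed_problem_solution[OF F C, of n]) blast+
  then obtain s u where s: "\<And>n. \<bar>s n\<bar> \<le> C" and u: "\<And>n. continuous_on {0..1} (u n)" "\<And>n. u n 1 = 0"
    and eq: "\<And>n t. t \<in> {0..1} \<Longrightarrow> u n t = s n * t - volterra (\<lambda>\<tau>. F \<tau> (u n (max 0 (\<tau> - d n)))) t"
    by metis
  have "C \<ge> 0" using C[of 0 0] by auto
  have cont_F: "continuous_on {0..1} (\<lambda>\<tau>. F \<tau> (u n (max 0 (\<tau> - d n))))" for n
  proof -
    have "continuous_on {0..1} (\<lambda>\<tau>. u n (max 0 (\<tau> - d n)))"
      using d(1)[of n] by (intro continuous_on_compose2[OF u(1)]) (auto intro!: continuous_intros)
    hence "continuous_on {0..1} (\<lambda>\<tau>. (\<lambda>(t, x). F t x) (\<tau>, u n (max 0 (\<tau> - d n))))"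
      by (intro continuous_on_compose2[OF F]) (auto intro!: continuous_intros)
    thus ?thesis by simp
  qed
  have lip: "\<bar>u n t - u n t'\<bar> \<le> 2 * C * \<bar>t - t'\<bar>" if "t \<in> {0..1}" "t' \<in> {0..1}" for n t t'
  proof -
    have "\<bar>s n * t - s n * t'\<bar> \<le> C * \<bar>t - t'\<bar>"
      using mult_right_mono[OF s[of n], of "\<bar>t - t'\<bar>"]
      by (simp add: abs_mult[symmetric] right_diff_distrib)
    thus ?thesis
      using volterra_lipschitz[OF cont_F[of n] C, of t t'] eq[OF that(1), of n] eq[OF that(2), of n]
      by auto
  qed
  have bound: "norm (u n t) \<le> 2 * C" if "t \<in> {0..1}" for n t
    using lip[OF that, of 1 n] u(2)[of n] that \<open>C \<ge> 0\<close> mult_left_mono[of "\<bar>t - 1\<bar>" 1 "2 * C"]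
    by auto
  obtain w k where w: "continuous_on {0..1} w" and k: "strict_mono (k :: nat \<Rightarrow> nat)"
    and unif: "\<And>e. 0 < e \<Longrightarrow> \<exists>N. \<forall>n x. n \<ge> N \<and> x \<in> {0..1} \<longrightarrow> norm (u (k n) x - w x) < e"
  proof (rule Arzela_Ascoli[of "{0..1::real}" u "2 * C"])
    fix x e :: real assume x: "x \<in> {0..1}" and e: "0 < e"
    show "\<exists>d>0. \<forall>n y. y \<in> {0..1} \<and> norm (x - y) < d \<longrightarrow> norm (u n x - u n y) < e"
    proof (intro exI conjI allI impI)
      \<comment> \<open>The added 1 covers the case \<open>C = 0\<close>.\<close>
      show "e / (2 * C + 1) > 0" using e \<open>C \<ge> 0\<close> by simp
      fix n y assume y: "y \<in> {0..1} \<and> norm (x - y) < e / (2 * C + 1)"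
      have "(2 * C + 1) * \<bar>x - y\<bar> < e"
        using y \<open>C \<ge> 0\<close> by (simp add: pos_less_divide_eq mult_ac)
      moreover have "norm (u n x - u n y) \<le> (2 * C + 1) * \<bar>x - y\<bar>"
        using lip[OF x, of y n] y by (simp add: algebra_simps)
      ultimately show "norm (u n x - u n y) < e" by linarith
    qed
  qed (use bound in auto)
  have dk: "(\<lambda>n. d (k n)) \<longlonglongrightarrow> 0"
  proof -
    have "d \<longlonglongrightarrow> 0"
      unfolding d_def using lim_1_over_n LIMSEQ_Suc by blast
    from LIMSEQ_subseq_LIMSEQ[OF this k] show ?thesis by (simp add: o_def)
  qed
  have lim: "(\<lambda>n. u (k n) t) \<longlonglongrightarrow> w t" if "t \<in> {0..1}" for t
    unfolding LIMSEQ_iff using unif that by meson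
  \<comment> \<open>The delay moves the argument by at most \<open>d (k n)\<close>, which the common
    Lipschitz constant turns into an error tending to 0.\<close>
  have delayed: "(\<lambda>n. u (k n) (max 0 (t - d (k n)))) \<longlonglongrightarrow> w t" if t: "t \<in> {0..1}" for t
  proof -
    have "(\<lambda>n. u (k n) (max 0 (t - d (k n))) - u (k n) t) \<longlonglongrightarrow> 0"
    proof (rule Lim_null_comparison)
      show "\<forall>\<^sub>F n in sequentially. norm (u (k n) (max 0 (t - d (k n))) - u (k n) t) \<le> 2 * C * d (k n)"
      proof (intro always_eventually allI)
        fix n
        have "max 0 (t - d (k n)) \<in> {0..1}" "\<bar>max 0 (t - d (k n)) - t\<bar> \<le> d (k n)"
          using t d[of "k n"] by auto
        with lip[OF this(1) t, of "k n"] mult_left_mono[OF this(2), of "2 * C"] \<open>C \<ge> 0\<close>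
        show "norm (u (k n) (max 0 (t - d (k n))) - u (k n) t) \<le> 2 * C * d (k n)" by simp
      qed
      show "(\<lambda>n. 2 * C * d (k n)) \<longlonglongrightarrow> 0"
        using tendsto_mult_right_zero[OF dk] .
    qed
    from tendsto_add[OF this lim[OF t]] show ?thesis by simp
  qed
  have limF: "(\<lambda>n. F t (u (k n) (max 0 (t - d (k n))))) \<longlonglongrightarrow> F t (w t)" if t: "t \<in> {0..1}" for t
  proof -
    have "continuous_on UNIV (\<lambda>x. (\<lambda>(t, x). F t x) (t, x))"
      using t by (intro continuous_on_compose2[OF F]) (auto intro!: continuous_intros)
    hence "continuous_on UNIV (F t)" by simp
    from continuous_on_tendsto_compose[OF this delayed[OF t]] show ?thesis by simp
  qed
  have limV: "(\<lambda>n. volterra (\<lambda>\<tau>. F \<tau> (u (k n) (max 0 (\<tau> - d (k n))))) t)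
      \<longlonglongrightarrow> volterra (\<lambda>\<tau>. F \<tau> (w \<tau>)) t" if "t \<in> {0..1}" for t
    using cont_F C limF that by (intro volterra_tendsto[where C = C]) auto
  \<comment> \<open>Convergence of the slopes takes no further subsequence: \<open>u n 1 = 0\<close>
    expresses each slope as a Volterra integral at 1, and these integrals converge.\<close>
  define s' where "s' = volterra (\<lambda>\<tau>. F \<tau> (w \<tau>)) 1"
  have sk: "s (k n) = volterra (\<lambda>\<tau>. F \<tau> (u (k n) (max 0 (\<tau> - d (k n))))) 1" for n
    using eq[of 1 "k n"] u(2)[of "k n"] by simp
  have w_eq: "w t = s' * t - volterra (\<lambda>\<tau>. F \<tau> (w \<tau>)) t" if t: "t \<in> {0..1}" for t
  proof (rule LIMSEQ_unique[OF lim[OF t]])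
    have "(\<lambda>n. s (k n) * t - volterra (\<lambda>\<tau>. F \<tau> (u (k n) (max 0 (\<tau> - d (k n))))) t)
        \<longlonglongrightarrow> s' * t - volterra (\<lambda>\<tau>. F \<tau> (w \<tau>)) t"
      unfolding s'_def sk using t by (intro tendsto_intros limV) auto
    thus "(\<lambda>n. u (k n) t) \<longlonglongrightarrow> s' * t - volterra (\<lambda>\<tau>. F \<tau> (w \<tau>)) t"
      using eq[OF t] by simp
  qed
  show ?thesis
    by (rule that[OF w _ _ w_eq]) (use w_eq[of 0] w_eq[of 1] in \<open>auto simp: s'_def\<close>)
qed

subsection \<open>Linear Volterra equations\<close>

lemma continuous_on_interval_bounded:
  fixes m :: "real \<Rightarrow> real"
  assumes "continuous_on {a..b} m"
  obtains M where "M > 0" "\<And>t. t \<in> {a..b} \<Longrightarrow> \<bar>m t\<bar> \<le> M"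
proof -
  have "bounded (m ` {a..b})"
    by (intro compact_imp_bounded compact_continuous_image assms) auto
  thus ?thesis using that unfolding bounded_pos by auto
qed

text \<open>Estimating the kernel by 1 leaves a single integration of \<open>\<tau> ^ k\<close>,
  hence a factor \<open>1 / (k + 1)\<close> per step; these factors build the factorials in the
  coefficient bound.\<close>

lemma volterra_power_bound:
  assumes h: "continuous_on {0..1} h" and t: "t \<in> {0..1}" and B: "B \<ge> 0"
    and le: "\<And>\<tau>. \<tau> \<in> {0..1} \<Longrightarrow> \<bar>h \<tau>\<bar> \<le> B * \<tau> ^ k"
  shows "\<bar>volterra h t\<bar> \<le> B * t ^ Suc k / real (Suc k)"
proof -
  have "((\<lambda>\<tau>. B * \<tau> ^ k) has_integral B / real (Suc k) * t ^ Suc k - B / real (Suc k) * 0 ^ Suc k) {0..t}"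
  proof (rule fundamental_theorem_of_calculus)
    fix x assume "x \<in> {0..t}"
    have "((\<lambda>x. B / real (Suc k) * x ^ Suc k) has_real_derivative B * x ^ k) (at x within {0..t})"
      by (rule DERIV_cmult[THEN DERIV_cong, OF DERIV_pow]) (simp del: of_nat_Suc)
    thus "((\<lambda>x. B / real (Suc k) * x ^ Suc k) has_vector_derivative B * x ^ k) (at x within {0..t})"
      by (simp only: has_real_derivative_iff_has_vector_derivative)
  qed (use t in auto)
  hence pw: "((\<lambda>\<tau>. B * \<tau> ^ k) has_integral B * t ^ Suc k / real (Suc k)) {0..t}" by simp
  have "norm (integral {0..t} (\<lambda>\<tau>. (t - \<tau>) * h \<tau>)) \<le> integral {0..t} (\<lambda>\<tau>. B * \<tau> ^ k)"
  proof (rule integral_norm_bound_integral)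
    show "(\<lambda>\<tau>. (t - \<tau>) * h \<tau>) integrable_on {0..t}"
      using t by (intro integrable_continuous_interval continuous_intros continuous_on_subset[OF h]) auto
    fix \<tau> assume \<tau>: "\<tau> \<in> {0..t}"
    have "\<bar>(t - \<tau>) * h \<tau>\<bar> \<le> 1 * (B * \<tau> ^ k)"
      unfolding abs_mult using \<tau> t le[of \<tau>] by (intro mult_mono) auto
    thus "norm ((t - \<tau>) * h \<tau>) \<le> B * \<tau> ^ k" by simp
  qed (use pw in blast)
  thus ?thesis
    using volterra_eq[OF h t] integral_unique[OF pw] by simp
qed

lemma volterra_sum:
  fixes n :: nat
  assumes "\<And>i. continuous_on {0..1} (h i)"
  shows "volterra (\<lambda>\<tau>. \<Sum>i<n. c i * h i \<tau>) t = (\<Sum>i<n. c i * volterra (h i) t)"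
proof -
  have "volterra (\<lambda>\<tau>. \<Sum>i<n. c i * h i \<tau>) t
      = integral {0..1} (\<lambda>\<tau>. \<Sum>i<n. c i * (max 0 (t - \<tau>) * h i \<tau>))"
    unfolding volterra_def by (simp add: sum_distrib_left mult_ac)
  also have "\<dots> = (\<Sum>i<n. integral {0..1} (\<lambda>\<tau>. c i * (max 0 (t - \<tau>) * h i \<tau>)))"
    by (intro integral_sum integrable_continuous_interval continuous_intros assms finite_lessThan)
  finally show ?thesis by (simp add: volterra_def)
qed

text \<open>The coefficient of \<open>(- l) ^ k\<close> in the Neumann series for the solution of
  \<open>y = g - l * volterra (m y)\<close>.\<close>

fun volterra_coeff :: "(real \<Rightarrow> real) \<Rightarrow> (real \<Rightarrow> real) \<Rightarrow> nat \<Rightarrow> real \<Rightarrow> real" where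
  "volterra_coeff m g 0 = g"
| "volterra_coeff m g (Suc k) = volterra (\<lambda>\<tau>. m \<tau> * volterra_coeff m g k \<tau>)"

lemma continuous_on_volterra_coeff:
  assumes "continuous_on {0..1} m" "continuous_on {0..1} g"
  shows "continuous_on {0..1} (volterra_coeff m g k)"
  by (induction k) (auto intro!: assms continuous_on_volterra continuous_intros)

lemma volterra_coeff_bound:
  assumes m: "continuous_on {0..1} m" and g: "continuous_on {0..1} g"
    and M: "\<And>t. t \<in> {0..1} \<Longrightarrow> \<bar>m t\<bar> \<le> M" and G: "\<And>t. t \<in> {0..1} \<Longrightarrow> \<bar>g t\<bar> \<le> G"
  shows "t \<in> {0..1} \<Longrightarrow> \<bar>volterra_coeff m g k t\<bar> \<le> G * M ^ k / fact k * t ^ k"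
proof (induction k arbitrary: t)
  case (Suc k)
  have nn: "M \<ge> 0" "G \<ge> 0" using M[of 0] G[of 0] by auto
  have "\<bar>volterra (\<lambda>\<tau>. m \<tau> * volterra_coeff m g k \<tau>) t\<bar>
      \<le> (M * (G * M ^ k / fact k)) * t ^ Suc k / real (Suc k)"
  proof (rule volterra_power_bound)
    fix \<tau> :: real assume \<tau>: "\<tau> \<in> {0..1}"
    have "\<bar>m \<tau> * volterra_coeff m g k \<tau>\<bar> \<le> M * (G * M ^ k / fact k * \<tau> ^ k)"
      unfolding abs_mult using \<tau> nn by (intro mult_mono M Suc.IH) auto
    thus "\<bar>m \<tau> * volterra_coeff m g k \<tau>\<bar> \<le> M * (G * M ^ k / fact k) * \<tau> ^ k"
      by (simp only: mult.assoc)
  qed (use nn Suc.prems in \<open>auto intro!: continuous_intros m continuous_on_volterra_coeff g\<close>)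
  thus ?case by (simp add: field_simps)
qed (use G in auto)

text \<open>An exponential series dominates the Neumann series on
  \<open>[0, L] \<times> [0, 1]\<close>, so the M-test makes the sum jointly continuous. Joint
  continuity is what later makes the set of zeros compact.\<close>

lemma linear_volterra_equation:
  fixes m g :: "real \<Rightarrow> real"
  assumes m: "continuous_on {0..1} m" and g: "continuous_on {0..1} g"
  obtains y :: "real \<Rightarrow> real \<Rightarrow> real" where
    "\<And>L. continuous_on ({0..L} \<times> {0..1}) (\<lambda>(l, t). y l t)"
    "\<And>l t. l \<ge> 0 \<Longrightarrow> t \<in> {0..1} \<Longrightarrow> y l t = g t - l * volterra (\<lambda>\<tau>. m \<tau> * y l \<tau>) t"
proof -
  define a where "a = volterra_coeff m g"
  define S where "S n l t = (\<Sum>i<n. (- l) ^ i * a i t)" for n and l t :: real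
  define y where "y l t = (\<Sum>i. (- l) ^ i * a i t)" for l t :: real
  have a: "continuous_on {0..1} (a i)" for i
    unfolding a_def by (intro continuous_on_volterra_coeff m g)
  obtain M where M: "\<And>t. t \<in> {0..1} \<Longrightarrow> \<bar>m t\<bar> \<le> M"
    using continuous_on_interval_bounded[OF m] by metis
  obtain G where G: "\<And>t. t \<in> {0..1} \<Longrightarrow> \<bar>g t\<bar> \<le> G"
    using continuous_on_interval_bounded[OF g] by metis
  have nn: "M \<ge> 0" "G \<ge> 0" using M[of 0] G[of 0] by auto
  \<comment> \<open>The terms of the series of \<open>G * exp (L * M)\<close>.\<close>
  define B where "B L i = G * (inverse (fact i) * (L * M) ^ i)" for L :: real and i
  have term_bound: "\<bar>(- l) ^ i * a i t\<bar> \<le> B L i" if "l \<in> {0..L}" "t \<in> {0..1}" for l t L i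
  proof -
    have "\<bar>a i t\<bar> \<le> G * M ^ i / fact i * t ^ i"
      using volterra_coeff_bound[OF m g M G that(2)] by (simp add: a_def)
    also have "\<dots> \<le> G * M ^ i / fact i * 1"
      using that nn by (intro mult_left_mono power_le_one) auto
    finally have "\<bar>(- l) ^ i\<bar> * \<bar>a i t\<bar> \<le> L ^ i * (G * M ^ i / fact i * 1)"
      using that by (intro mult_mono) (auto simp: power_abs power_mono)
    thus ?thesis by (simp add: B_def abs_mult field_simps)
  qed
  have B_sum: "summable (B L)" for L
    unfolding B_def by (intro summable_mult summable_exp)
  have unif: "uniform_limit ({0..L} \<times> {0..1}) (\<lambda>n (l, t). S n l t) (\<lambda>(l, t). y l t) sequentially" for L
    using Weierstrass_m_test[of "{0..L} \<times> {0..1}" "\<lambda>i (l, t). (- l) ^ i * a i t" "B L"]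
      term_bound B_sum by (auto simp: S_def[abs_def] y_def[abs_def] case_prod_unfold)
  have cont_S: "continuous_on ({0..L} \<times> {0..1}) (\<lambda>(l, t). S n l t)" for L n
  proof -
    have "continuous_on ({0..L} \<times> {0..1}) (\<lambda>z. a i (snd z))" for i
      by (rule continuous_on_compose2[OF a]) (auto intro!: continuous_intros)
    thus ?thesis
      unfolding S_def case_prod_unfold by (intro continuous_intros)
  qed
  have cont_y: "continuous_on ({0..L} \<times> {0..1}) (\<lambda>(l, t). y l t)" for L
    by (rule uniform_limit_theorem[OF _ unif]) (auto intro!: always_eventually cont_S)
  have lim: "(\<lambda>n. S n l t) \<longlonglongrightarrow> y l t" if "l \<ge> 0" "t \<in> {0..1}" for l t
    using tendsto_uniform_limitI[OF unif[of l], of "(l, t)"] that by simp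
  \<comment> \<open>Splitting off the term of index 0 shows that the partial sums are Picard
    iterates; the equation follows by passing to the limit on both sides.\<close>
  have S_Suc: "S (Suc n) l t = g t - l * volterra (\<lambda>\<tau>. m \<tau> * S n l \<tau>) t" for n l t
  proof -
    have "volterra (\<lambda>\<tau>. m \<tau> * S n l \<tau>) t = volterra (\<lambda>\<tau>. \<Sum>i<n. (- l) ^ i * (m \<tau> * a i \<tau>)) t"
      by (simp add: S_def sum_distrib_left mult_ac)
    also have "\<dots> = (\<Sum>i<n. (- l) ^ i * volterra (\<lambda>\<tau>. m \<tau> * a i \<tau>) t)"
      by (intro volterra_sum continuous_intros m a)
    also have "\<dots> = (\<Sum>i<n. (- l) ^ i * a (Suc i) t)"
      by (simp add: a_def)
    finally have *: "volterra (\<lambda>\<tau>. m \<tau> * S n l \<tau>) t = (\<Sum>i<n. (- l) ^ i * a (Suc i) t)" .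
    show ?thesis
      unfolding * unfolding S_def sum.lessThan_Suc_shift
      by (simp add: a_def sum_distrib_left sum_negf[symmetric] mult_ac)
  qed
  have "y l t = g t - l * volterra (\<lambda>\<tau>. m \<tau> * y l \<tau>) t" if l: "l \<ge> 0" and t: "t \<in> {0..1}" for l t
  proof (rule LIMSEQ_unique[OF LIMSEQ_Suc[OF lim[OF l t]]])
    \<comment> \<open>The sum of the majorant bounds all partial sums at once and so yields the
      dominating constant.\<close>
    have "(\<lambda>n. volterra (\<lambda>\<tau>. m \<tau> * S n l \<tau>) t) \<longlonglongrightarrow> volterra (\<lambda>\<tau>. m \<tau> * y l \<tau>) t"
    proof (rule volterra_tendsto[where C = "M * suminf (B l)"])
      fix n
      show "continuous_on {0..1} (\<lambda>\<tau>. m \<tau> * S n l \<tau>)"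
        unfolding S_def by (intro continuous_intros m a)
      fix \<tau> :: real assume \<tau>: "\<tau> \<in> {0..1}"
      have "\<bar>S n l \<tau>\<bar> \<le> (\<Sum>i<n. B l i)"
        unfolding S_def using l \<tau> by (intro order_trans[OF sum_abs] sum_mono term_bound) auto
      also have "\<dots> \<le> suminf (B l)"
        using l nn by (intro sum_le_suminf B_sum) (auto simp: B_def)
      finally have "\<bar>S n l \<tau>\<bar> \<le> suminf (B l)" .
      thus "\<bar>m \<tau> * S n l \<tau>\<bar> \<le> M * suminf (B l)"
        unfolding abs_mult using M[OF \<tau>] nn by (intro mult_mono) auto
    qed (use l t lim in \<open>auto intro!: tendsto_intros\<close>)
    thus "(\<lambda>n. S (Suc n) l t) \<longlonglongrightarrow> g t - l * volterra (\<lambda>\<tau>. m \<tau> * y l \<tau>) t"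
      unfolding S_Suc by (intro tendsto_intros)
  qed
  with cont_y that show ?thesis by blast
qed

lemma volterra_solution_C2:
  assumes h: "continuous_on {0..1} h" and y: "\<And>t. t \<in> {0..1} \<Longrightarrow> y t = g t - volterra h t"
    and g: "\<And>t. t \<in> {0<..<1} \<Longrightarrow> (g has_real_derivative g1 t) (at t)"
    and g1: "\<And>t. t \<in> {0<..<1} \<Longrightarrow> (g1 has_real_derivative g2 t) (at t)"
    and t: "t \<in> {0<..<1}"
  shows "(y has_real_derivative g1 t - integral {0..t} h) (at t)"
    and "((\<lambda>t. g1 t - integral {0..t} h) has_real_derivative g2 t - h t) (at t)"
proof -
  have "((\<lambda>t. g t - volterra h t) has_real_derivative g1 t - integral {0..t} h) (at t)"
    by (intro derivative_intros g has_real_derivative_volterra h t)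
  thus "(y has_real_derivative g1 t - integral {0..t} h) (at t)"
    by (rule has_field_derivative_transform_within_open[where S = "{0<..<1}"]) (use t y in auto)
  show "((\<lambda>t. g1 t - integral {0..t} h) has_real_derivative g2 t - h t) (at t)"
    by (intro derivative_intros g1 has_real_derivative_integral_open h t)
qed

subsection \<open>The principal eigenvalue\<close>

lemma MVT_open:
  fixes f :: "real \<Rightarrow> real"
  assumes "a < b" "continuous_on {a..b} f"
    and "\<And>x. x \<in> {a<..<b} \<Longrightarrow> (f has_real_derivative f' x) (at x)"
  obtains z where "z \<in> {a<..<b}" "f b - f a = (b - a) * f' z"
proof -
  have "\<exists>l z. a < z \<and> z < b \<and> (f has_real_derivative l) (at z) \<and> f b - f a = (b - a) * l"
    by (rule MVT[OF assms(1,2)]) (use assms(3) in \<open>force simp: real_differentiable_def\<close>)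
  then obtain l z where z: "a < z" "z < b" "(f has_real_derivative l) (at z)" "f b - f a = (b - a) * l"
    by blast
  moreover have "l = f' z" using z by (intro DERIV_unique[OF z(3) assms(3)]) auto
  ultimately show ?thesis using that[of z] by auto
qed

text \<open>Were \<open>D > 0\<close>, the slope, which is 0 at the maximum, would be positive just
  to the right of it, and the mean value theorem would give a larger value of \<open>w\<close>
  there.\<close>

lemma second_derivative_at_max:
  fixes w :: "real \<Rightarrow> real"
  assumes t: "t \<in> {a<..<b}" and w: "\<And>x. x \<in> {a<..<b} \<Longrightarrow> (w has_real_derivative w1 x) (at x)"
    and w1: "(w1 has_real_derivative D) (at t)"
    and max: "\<And>x. x \<in> {a<..<b} \<Longrightarrow> w x \<le> w t"
  shows "D \<le> 0"
proof (rule ccontr)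
  assume "\<not> D \<le> 0"
  hence D: "D > 0" by simp
  have "w1 t = 0"
  proof (rule DERIV_local_max[OF w[OF t]])
    show "min (t - a) (b - t) > 0" using t by auto
    show "\<forall>y. \<bar>t - y\<bar> < min (t - a) (b - t) \<longrightarrow> w y \<le> w t"
      by (intro allI impI max) (auto simp: abs_less_iff)
  qed
  with DERIV_pos_inc_right[OF w1 D] obtain d where
    d: "d > 0" "\<And>h. 0 < h \<Longrightarrow> h < d \<Longrightarrow> 0 < w1 (t + h)" by auto
  define r where "r = min d (b - t)"
  have r: "0 < r" "r \<le> d" "r \<le> b - t" using d(1) t by (auto simp: r_def)
  define x where "x = t + r / 2"
  have x: "t < x" "x < b" "x < t + d" using r unfolding x_def by simp_all
  obtain z where z: "z \<in> {t<..<x}" "w x - w t = (x - t) * w1 z"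
  proof (rule MVT_open[OF x(1), of w w1])
    show "continuous_on {t..x} w"
      using x t by (intro DERIV_continuous_on[OF has_field_derivative_at_within[OF w]]) auto
  qed (use x t w in auto)
  have "w1 z > 0" using d(2)[of "z - t"] z(1) x by auto
  hence "(x - t) * w1 z > 0" using x by (intro mult_pos_pos) auto
  hence "w x > w t" using z(2) by linarith
  moreover have "w x \<le> w t" using x t by (intro max) auto
  ultimately show False by simp
qed

lemma ivp_derivatives:
  assumes m: "continuous_on {0..1} m" and y: "continuous_on {0..1} y"
    and eq: "\<And>t. t \<in> {0..1} \<Longrightarrow> y t = t - l * volterra (\<lambda>\<tau>. m \<tau> * y \<tau>) t"
    and t: "t \<in> {0<..<1}"
  defines "y1 \<equiv> \<lambda>t. 1 - l * integral {0..t} (\<lambda>\<tau>. m \<tau> * y \<tau>)"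
  shows "(y has_real_derivative y1 t) (at t)"
    and "(y1 has_real_derivative - l * m t * y t) (at t)"
proof -
  have my: "continuous_on {0..1} (\<lambda>\<tau>. m \<tau> * y \<tau>)"
    by (intro continuous_intros m y)
  have "((\<lambda>t. t - l * volterra (\<lambda>\<tau>. m \<tau> * y \<tau>) t) has_real_derivative y1 t) (at t)"
    unfolding y1_def
    by (rule derivative_eq_intros refl has_real_derivative_volterra my t)+ simp
  thus "(y has_real_derivative y1 t) (at t)"
    by (rule has_field_derivative_transform_within_open[where S = "{0<..<1}"]) (use t eq in auto)
  show "(y1 has_real_derivative - l * m t * y t) (at t)"
    unfolding y1_def
    by (rule derivative_eq_intros refl has_real_derivative_integral_open my t)+ simp
qed

text \<open>Concavity of a nonnegative solution, phrased through the integral formula for its slope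
  so that it reaches the endpoints 0 and 1.\<close>

lemma ivp_slope_antimono:
  fixes m y :: "real \<Rightarrow> real"
  assumes m: "continuous_on {0..1} m" and y: "continuous_on {0..1} y"
    and nonneg: "\<And>t. t \<in> {0..1} \<Longrightarrow> m t \<ge> 0" "\<And>t. t \<in> {0..1} \<Longrightarrow> y t \<ge> 0"
    and "l \<ge> 0" "0 \<le> s" "s \<le> t" "t \<le> 1"
  shows "1 - l * integral {0..t} (\<lambda>\<tau>. m \<tau> * y \<tau>) \<le> 1 - l * integral {0..s} (\<lambda>\<tau>. m \<tau> * y \<tau>)"
proof -
  have my: "continuous_on {0..1} (\<lambda>\<tau>. m \<tau> * y \<tau>)"
    by (intro continuous_intros m y)
  have "integral {0..s} (\<lambda>\<tau>. m \<tau> * y \<tau>) \<le> integral {0..t} (\<lambda>\<tau>. m \<tau> * y \<tau>)"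
    using assms
    by (intro integral_subset_le integrable_continuous_interval continuous_on_subset[OF my]) auto
  with \<open>l \<ge> 0\<close> show ?thesis by (simp add: mult_left_mono)
qed

text \<open>Concavity bounds \<open>y' / y\<close> above by \<open>1 / \<alpha>\<close> at
  \<open>\<alpha>\<close> and below by \<open>- (1 / (1 - \<beta>))\<close> at
  \<open>\<beta>\<close>, while the Riccati equation makes it fall at rate at least
  \<open>l * m0\<close> in between. Hence for large \<open>l\<close> a zero must appear in
  \<open>(0, 1]\<close>.\<close>

lemma positive_ivp_parameter_bound:
  assumes m: "continuous_on {0..1} m" and m_nonneg: "\<And>t. t \<in> {0..1} \<Longrightarrow> m t \<ge> 0"
    and y: "continuous_on {0..1} y" and l: "l \<ge> 0"
    and eq: "\<And>t. t \<in> {0..1} \<Longrightarrow> y t = t - l * volterra (\<lambda>\<tau>. m \<tau> * y \<tau>) t"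
    and pos: "\<And>t. t \<in> {0<..1} \<Longrightarrow> y t > 0"
    and ab: "0 < \<alpha>" "\<alpha> < \<beta>" "\<beta> < 1" and m0: "\<And>t. t \<in> {\<alpha>..\<beta>} \<Longrightarrow> m t \<ge> m0"
  shows "l * m0 * (\<beta> - \<alpha>) \<le> 1 / \<alpha> + 1 / (1 - \<beta>)"
proof -
  define y1 where "y1 = (\<lambda>t. 1 - l * integral {0..t} (\<lambda>\<tau>. m \<tau> * y \<tau>))"
  have D: "(y has_real_derivative y1 t) (at t)" "(y1 has_real_derivative - l * m t * y t) (at t)"
    if "t \<in> {0<..<1}" for t
    using ivp_derivatives[OF m y eq that] by (simp_all add: y1_def)
  have y0: "y 0 = 0" using eq[of 0] by simp
  hence y_nonneg: "y t \<ge> 0" if "t \<in> {0..1}" for t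
    using pos[of t] that by (cases "t = 0") auto
  have anti: "y1 t \<le> y1 s" if "0 \<le> s" "s \<le> t" "t \<le> 1" for s t
    unfolding y1_def by (rule ivp_slope_antimono[OF m y m_nonneg y_nonneg l that]) auto
  \<comment> \<open>The mean slope on \<open>[0, \<alpha>]\<close> is at least the final slope
    \<open>y1 \<alpha>\<close>.\<close>
  obtain z where z: "z \<in> {0<..<\<alpha>}" "y \<alpha> - y 0 = (\<alpha> - 0) * y1 z"
    by (rule MVT_open[of 0 \<alpha> y y1]) (use ab D in \<open>auto intro!: continuous_on_subset[OF y]\<close>)
  have "\<alpha> * y1 \<alpha> \<le> y \<alpha>"
    using z y0 ab anti[of z \<alpha>] by (simp add: mult_left_mono)
  hence left: "y1 \<alpha> / y \<alpha> \<le> 1 / \<alpha>"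
    using ab pos[of \<alpha>] by (simp add: field_simps)
  \<comment> \<open>The mean slope on \<open>[\<beta>, 1]\<close> is at most
    \<open>y1 \<beta>\<close>, and \<open>y 1 > 0\<close> limits the drop to
    \<open>y \<beta>\<close>.\<close>
  obtain x where x: "x \<in> {\<beta><..<1}" "y 1 - y \<beta> = (1 - \<beta>) * y1 x"
    by (rule MVT_open[of \<beta> 1 y y1]) (use ab D in \<open>auto intro!: continuous_on_subset[OF y]\<close>)
  have "(1 - \<beta>) * y1 x \<le> (1 - \<beta>) * y1 \<beta>"
    using x ab anti[of \<beta> x] by (intro mult_left_mono) auto
  moreover have "y 1 > 0" by (simp add: pos)
  ultimately have "- y \<beta> \<le> (1 - \<beta>) * y1 \<beta>" using x(2) by linarith
  hence right: "- (1 / (1 - \<beta>)) \<le> y1 \<beta> / y \<beta>"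
    using ab pos[of \<beta>] by (simp add: field_simps)
  \<comment> \<open>Riccati: \<open>(y'/y)' = - l m - (y'/y)\<^sup>2\<close>.\<close>
  have DR: "((\<lambda>t. y1 t / y t) has_real_derivative - l * m t - (y1 t / y t)\<^sup>2) (at t)"
    if "t \<in> {\<alpha>..\<beta>}" for t
  proof -
    have t: "t \<in> {0<..<1}" "y t > 0" using that ab pos by auto
    show ?thesis
      by (rule DERIV_cong[OF DERIV_divide[OF D(2)[OF t(1)] D(1)[OF t(1)]]])
        (use t in \<open>auto simp: field_simps power2_eq_square\<close>)
  qed
  obtain \<xi> where \<xi>: "\<xi> \<in> {\<alpha><..<\<beta>}"
    "y1 \<beta> / y \<beta> - y1 \<alpha> / y \<alpha> = (\<beta> - \<alpha>) * (- l * m \<xi> - (y1 \<xi> / y \<xi>)\<^sup>2)"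
    by (rule MVT_open[of \<alpha> \<beta> "\<lambda>t. y1 t / y t" "\<lambda>t. - l * m t - (y1 t / y t)\<^sup>2"])
      (use ab DR in \<open>auto intro!: DERIV_continuous_on[OF has_field_derivative_at_within[OF DR]]\<close>)
  have "(\<beta> - \<alpha>) * (l * m0) \<le> (\<beta> - \<alpha>) * (l * m \<xi> + (y1 \<xi> / y \<xi>)\<^sup>2)"
    using \<xi>(1) ab l m0[of \<xi>] by (intro mult_left_mono add_increasing2) auto
  with \<xi>(2) left right show ?thesis by (simp add: algebra_simps)
qed

text \<open>\<open>y\<close> vanishes at 0 and lacks the term 1. The solution \<open>e\<close> of
  \<open>- e'' = l m e + 1\<close> with \<open>e(0) = 1\<close>, \<open>e'(0) = 0\<close> supplies
  this term and is positive near 0; away from 0 a large multiple of \<open>y\<close> outweighs any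
  negative values of \<open>e\<close>.\<close>

lemma positive_strict_supersolution:
  assumes m: "continuous_on {0..1} m" and y: "continuous_on {0..1} y" and l: "l \<ge> 0"
    and eq: "\<And>t. t \<in> {0..1} \<Longrightarrow> y t = t - l * volterra (\<lambda>\<tau>. m \<tau> * y \<tau>) t"
    and pos: "\<And>t. t \<in> {0<..1} \<Longrightarrow> y t > 0"
  shows "\<exists>\<psi>. continuous_on {0..1} \<psi> \<and> (\<forall>t\<in>{0..1}. \<psi> t > 0)
    \<and> C2_open01 \<psi> (\<lambda>t. - l * m t * \<psi> t - 1)"
proof -
  \<comment> \<open>The function \<open>1 - t\<^sup>2 / 2\<close> carries the initial data of
    \<open>e\<close> and the forcing term \<open>- 1\<close>.\<close>
  have cg: "continuous_on {0..1} (\<lambda>t::real. 1 - t\<^sup>2 / 2)" by (intro continuous_intros) auto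
  obtain E where E: "\<And>L. continuous_on ({0..L} \<times> {0..1}) (\<lambda>(l, t). E l t)"
    "\<And>l t. l \<ge> 0 \<Longrightarrow> t \<in> {0..1} \<Longrightarrow> E l t = 1 - t\<^sup>2 / 2 - l * volterra (\<lambda>\<tau>. m \<tau> * E l \<tau>) t"
    using linear_volterra_equation[OF m cg] by blast
  define e where "e = E l"
  have "continuous_on {0..1} (\<lambda>t. (\<lambda>(l, t). E l t) (l, t))"
    using l by (intro continuous_on_compose2[OF E(1)[of l]]) (auto intro!: continuous_intros)
  hence e: "continuous_on {0..1} e" by (simp add: e_def)
  have e_eq: "e t = 1 - t\<^sup>2 / 2 - l * volterra (\<lambda>\<tau>. m \<tau> * e \<tau>) t" if "t \<in> {0..1}" for t
    using E(2)[OF l that] by (simp add: e_def)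
  have "e 0 = 1" using e_eq[of 0] by simp
  obtain d where d: "d > 0" "\<And>t. t \<in> {0..1} \<Longrightarrow> \<bar>t\<bar> < d \<Longrightarrow> \<bar>e t - 1\<bar> < 1"
    using e \<open>e 0 = 1\<close> unfolding continuous_on_iff dist_real_def
    by (metis atLeastAtMost_iff diff_zero order_refl zero_le_one zero_less_one)
  define t1 where "t1 = min d 1"
  have t1: "0 < t1" "t1 \<le> 1" "t1 \<le> d" using d(1) by (auto simp: t1_def)
  obtain B where B: "B > 0" "\<And>t. t \<in> {0..1} \<Longrightarrow> \<bar>e t\<bar> \<le> B"
    using continuous_on_interval_bounded[OF e] by metis
  obtain x where x: "x \<in> {t1..1}" "\<And>t. t \<in> {t1..1} \<Longrightarrow> y x \<le> y t"
  proof -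
    have "continuous_on {t1..1} y" using t1 by (intro continuous_on_subset[OF y]) auto
    from continuous_attains_inf[OF _ _ this] t1 that show ?thesis by auto
  qed
  have yx: "y x > 0" using x t1 by (intro pos) auto
  \<comment> \<open>On \<open>[t1, 1]\<close> this makes \<open>s * y t\<close> at least
    \<open>B + 1\<close>, which exceeds \<open>\<bar>e t\<bar>\<close>.\<close>
  define s where "s = (B + 1) / y x"
  have s: "s > 0" using B yx by (simp add: s_def)
  define \<psi> where "\<psi> t = s * y t + e t" for t
  have y0: "y 0 = 0" using eq[of 0] by simp
  have \<psi>_pos: "\<psi> t > 0" if t: "t \<in> {0..1}" for t
  proof (cases "t < t1")
    case True
    hence "e t > 0" using d(2)[OF t] t t1 by auto
    moreover have "y t \<ge> 0" using pos[of t] y0 t by (cases "t = 0") auto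
    ultimately show ?thesis using s by (simp add: \<psi>_def add_nonneg_pos)
  next
    case False
    hence "s * y x \<le> s * y t" using s t x(2)[of t] by simp
    moreover have "s * y x = B + 1" using yx by (simp add: s_def)
    ultimately show ?thesis using B(2)[OF t] by (simp add: \<psi>_def)
  qed
  have cont: "continuous_on {0..1} \<psi>"
    unfolding \<psi>_def by (intro continuous_intros y e)
  define e1 where "e1 t = - t - l * integral {0..t} (\<lambda>\<tau>. m \<tau> * e \<tau>)" for t
  have me: "continuous_on {0..1} (\<lambda>\<tau>. m \<tau> * e \<tau>)" by (intro continuous_intros m e)
  have De: "(e has_real_derivative e1 t) (at t)" if t: "t \<in> {0<..<1}" for t
  proof -
    have "((\<lambda>t. 1 - t\<^sup>2 / 2 - l * volterra (\<lambda>\<tau>. m \<tau> * e \<tau>) t) has_real_derivative e1 t) (at t)"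
      unfolding e1_def
      by (intro DERIV_diff DERIV_cmult has_real_derivative_volterra me t)
        (auto intro!: derivative_eq_intros)
    thus ?thesis
      by (rule has_field_derivative_transform_within_open[where S = "{0<..<1}"]) (use t e_eq in auto)
  qed
  have De1: "(e1 has_real_derivative - 1 - l * (m t * e t)) (at t)" if t: "t \<in> {0<..<1}" for t
    unfolding e1_def
    by (rule derivative_eq_intros refl has_real_derivative_integral_open me t)+ simp
  define y1 where "y1 = (\<lambda>t. 1 - l * integral {0..t} (\<lambda>\<tau>. m \<tau> * y \<tau>))"
  have D: "(y has_real_derivative y1 t) (at t)" "(y1 has_real_derivative - l * m t * y t) (at t)"
    if "t \<in> {0<..<1}" for t
    using ivp_derivatives[OF m y eq that] by (simp_all add: y1_def)
  have "C2_open01 \<psi> (\<lambda>t. - l * m t * \<psi> t - 1)"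
    unfolding C2_open01_def
  proof (intro exI conjI ballI)
    fix t :: real assume t: "t \<in> {0<..<1}"
    show "(\<psi> has_real_derivative s * y1 t + e1 t) (at t)"
      unfolding \<psi>_def by (rule DERIV_add[OF DERIV_cmult[OF D(1)[OF t]] De[OF t]])
    show "((\<lambda>t. s * y1 t + e1 t) has_real_derivative - l * m t * \<psi> t - 1) (at t)"
      by (rule DERIV_cong[OF DERIV_add[OF DERIV_cmult[OF D(2)[OF t]] De1[OF t]]])
        (simp add: \<psi>_def algebra_simps)
  next
    show "continuous_on {0<..<1} (\<lambda>t. - l * m t * \<psi> t - 1)"
      by (intro continuous_intros continuous_on_subset[OF m] continuous_on_subset[OF cont]) auto
  qed
  with cont \<psi>_pos show ?thesis by blast
qed

text \<open>Let \<open>k > 0\<close> be a positive maximum of \<open>v / \<psi>\<close> for an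
  eigenfunction \<open>v\<close>. Then \<open>v - k \<psi>\<close> has an interior maximum with
  value 0, yet its second derivative there is
  \<open>k (- \<psi>'' - l m \<psi>) > 0\<close>.\<close>

lemma strict_supersolution_excludes_eigenvalue:
  assumes \<psi>: "continuous_on {0..1} \<psi>" "\<And>t. t \<in> {0..1} \<Longrightarrow> \<psi> t > 0" "C2_open01 \<psi> \<psi>2"
    and strict: "\<And>t. t \<in> {0<..<1} \<Longrightarrow> - \<psi>2 t > l * m t * \<psi> t"
  shows "\<not> dirichlet_eigen m l u"
proof -
  have nonpos: "v t \<le> 0" if v: "dirichlet_eigen m l v" and t: "t \<in> {0<..<1}" for v t
  proof (rule ccontr)
    assume "\<not> v t \<le> 0"
    have cv: "continuous_on {0..1} v" and v01: "v 0 = 0" "v 1 = 0"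
      using v by (auto simp: dirichlet_eigen_def)
    obtain v1 v2 where D: "\<And>t. t \<in> {0<..<1} \<Longrightarrow> (v has_real_derivative v1 t) (at t)"
      "\<And>t. t \<in> {0<..<1} \<Longrightarrow> (v1 has_real_derivative v2 t) (at t)"
      and v2: "\<And>t. t \<in> {0<..<1} \<Longrightarrow> - v2 t = l * m t * v t"
      using v unfolding dirichlet_eigen_def C2_open01_def by blast
    obtain \<psi>1 where D\<psi>: "\<And>t. t \<in> {0<..<1} \<Longrightarrow> (\<psi> has_real_derivative \<psi>1 t) (at t)"
      "\<And>t. t \<in> {0<..<1} \<Longrightarrow> (\<psi>1 has_real_derivative \<psi>2 t) (at t)"
      using \<psi>(3) unfolding C2_open01_def by blast
    have "continuous_on {0..1} (\<lambda>t. v t / \<psi> t)"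
      using \<psi>(2) by (intro continuous_intros cv \<psi>(1)) force
    then obtain x where x: "x \<in> {0..1}" "\<And>s. s \<in> {0..1} \<Longrightarrow> v s / \<psi> s \<le> v x / \<psi> x"
      using continuous_attains_sup[of "{0..1::real}" "\<lambda>t. v t / \<psi> t"] by auto
    define k where "k = v x / \<psi> x"
    have "0 < v t / \<psi> t" using \<open>\<not> v t \<le> 0\<close> t \<psi>(2)[of t] by simp
    also have "\<dots> \<le> k" unfolding k_def using t by (intro x) auto
    finally have k: "k > 0" .
    have x': "x \<in> {0<..<1}"
    proof -
      have "x \<noteq> 0" "x \<noteq> 1" using k v01 by (auto simp: k_def)
      with x show ?thesis by auto
    qed
    have vx: "v x = k * \<psi> x" using \<psi>(2)[OF x(1)] by (simp add: k_def)
    have "v2 x - k * \<psi>2 x \<le> 0"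
    proof (rule second_derivative_at_max[OF x'])
      show "((\<lambda>t. v t - k * \<psi> t) has_real_derivative v1 s - k * \<psi>1 s) (at s)"
        if "s \<in> {0<..<1}" for s
        using that by (intro DERIV_diff DERIV_cmult D D\<psi>)
      show "((\<lambda>t. v1 t - k * \<psi>1 t) has_real_derivative v2 x - k * \<psi>2 x) (at x)"
        using x' by (intro DERIV_diff DERIV_cmult D D\<psi>)
      show "v s - k * \<psi> s \<le> v x - k * \<psi> x" if "s \<in> {0<..<1}" for s
      proof -
        have "v s / \<psi> s \<le> k" "\<psi> s > 0" using x(2)[of s] \<psi>(2)[of s] that by (auto simp: k_def)
        thus ?thesis using vx by (simp add: field_simps)
      qed
    qed
    moreover have "v2 x - k * \<psi>2 x = k * (- \<psi>2 x - l * m x * \<psi> x)"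
      using v2[OF x'] vx by (simp add: algebra_simps)
    moreover have "k * (- \<psi>2 x - l * m x * \<psi> x) > 0"
      using k strict[OF x'] by (intro mult_pos_pos) auto
    ultimately show False by simp
  qed
  show ?thesis
  proof
    assume u: "dirichlet_eigen m l u"
    \<comment> \<open>The comparison bounds an eigenfunction only from above; applied to
      \<open>u\<close> and to \<open>- u\<close> it forces \<open>u = 0\<close>.\<close>
    have "dirichlet_eigen m l (\<lambda>t. - u t)"
    proof -
      obtain u1 u2 where D: "\<And>t. t \<in> {0<..<1} \<Longrightarrow> (u has_real_derivative u1 t) (at t)"
        "\<And>t. t \<in> {0<..<1} \<Longrightarrow> (u1 has_real_derivative u2 t) (at t)"
        and u2: "continuous_on {0<..<1} u2" "\<And>t. t \<in> {0<..<1} \<Longrightarrow> - u2 t = l * m t * u t"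
        using u unfolding dirichlet_eigen_def C2_open01_def by blast
      have "C2_open01 (\<lambda>t. - u t) (\<lambda>t. - u2 t)"
        unfolding C2_open01_def
        by (intro exI[of _ "\<lambda>t. - u1 t"]) (auto intro!: derivative_intros continuous_intros D u2)
      moreover have "\<forall>t\<in>{0<..<1}. - (- u2 t) = l * m t * (- u t)"
        using u2(2) by force
      ultimately show ?thesis
        using u unfolding dirichlet_eigen_def by (auto intro!: continuous_intros)
    qed
    from nonpos[OF this] nonpos[OF u] have "\<forall>t\<in>{0<..<1}. u t = 0" by force
    with u show False by (auto simp: dirichlet_eigen_def)
  qed
qed

lemma positive_on_subinterval:
  fixes m :: "real \<Rightarrow> real"
  assumes m: "continuous_on {0..1} m" and x: "x \<in> {0..1}" "m x > 0"
  obtains \<alpha> \<beta> m0 where "0 < \<alpha>" "\<alpha> < \<beta>" "\<beta> < 1" "m0 > 0" "\<And>t. t \<in> {\<alpha>..\<beta>} \<Longrightarrow> m t \<ge> m0"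
proof -
  obtain d where d: "d > 0" "\<And>t. t \<in> {0..1} \<Longrightarrow> \<bar>t - x\<bar> < d \<Longrightarrow> \<bar>m t - m x\<bar> < m x / 2"
    using m x unfolding continuous_on_iff dist_real_def by (metis half_gt_zero)
  define r where "r = min d (1/2)"
  have r: "0 < r" "r \<le> d" "r \<le> 1/2" using d by (auto simp: r_def)
  \<comment> \<open>The point \<open>x\<close> may be an endpoint of \<open>[0, 1]\<close>, so the
    subinterval is placed beside it, on the side facing the interior, within distance
    \<open>r / 2\<close>.\<close>
  define \<alpha> where "\<alpha> = (if x \<le> 1/2 then x + r/4 else x - r/2)"
  have ab: "0 < \<alpha>" "\<alpha> + r / 4 < 1" using r x by (auto simp: \<alpha>_def)
  have "m t \<ge> m x / 2" if t: "t \<in> {\<alpha>..\<alpha> + r / 4}" for t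
  proof -
    have "\<bar>t - x\<bar> < d" using t r by (auto simp: \<alpha>_def split: if_splits)
    moreover have "t \<in> {0..1}" using t ab by auto
    ultimately show ?thesis using d(2)[of t] by linarith
  qed
  with that[of \<alpha> "\<alpha> + r / 4" "m x / 2"] ab r x show ?thesis by auto
qed

text \<open>\<open>y l\<close> is the solution with initial slope 1. The zeros of \<open>y\<close>
  in \<open>[0, L] \<times> [t1, 1]\<close> form a compact set, nonempty by the Riccati bound, so a
  least parameter with a zero is attained. Concavity then leaves 1 as the only place for that
  zero.\<close>

theorem principal_eigenpair:
  fixes m :: "real \<Rightarrow> real"
  assumes m: "continuous_on {0..1} m" and m_nonneg: "\<And>t. t \<in> {0..1} \<Longrightarrow> m t \<ge> 0"
    and m_nz: "\<exists>t\<in>{0..1}. m t \<noteq> 0"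
  obtains \<Lambda> \<phi> where "\<Lambda> > 0" "continuous_on {0..1} \<phi>" "\<phi> 0 = 0" "\<phi> 1 = 0"
    "\<And>t. t \<in> {0<..<1} \<Longrightarrow> \<phi> t > 0" "C2_open01 \<phi> (\<lambda>t. - \<Lambda> * m t * \<phi> t)"
    "\<And>l. 0 \<le> l \<Longrightarrow> l < \<Lambda> \<Longrightarrow> \<exists>\<psi>. continuous_on {0..1} \<psi> \<and> (\<forall>t\<in>{0..1}. \<psi> t > 0)
       \<and> C2_open01 \<psi> (\<lambda>t. - l * m t * \<psi> t - 1)"
proof -
  obtain y where cont: "\<And>L. continuous_on ({0..L} \<times> {0..1}) (\<lambda>(l, t). y l t)"
    and eq: "\<And>l t. l \<ge> 0 \<Longrightarrow> t \<in> {0..1} \<Longrightarrow> y l t = t - l * volterra (\<lambda>\<tau>. m \<tau> * y l \<tau>) t"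
    using linear_volterra_equation[OF m continuous_on_id] by blast
  have cont_t: "continuous_on {0..1} (y l)" if "l \<ge> 0" for l
  proof -
    have "continuous_on {0..1} (\<lambda>t. (\<lambda>(l, t). y l t) (l, t))"
      using that by (intro continuous_on_compose2[OF cont[of l]]) (auto intro!: continuous_intros)
    thus ?thesis by simp
  qed
  have cont_l: "continuous_on {0..L} (\<lambda>l. y l t)" if "t \<in> {0..1}" for L t
  proof -
    have "continuous_on {0..L} (\<lambda>l. (\<lambda>(l, t). y l t) (l, t))"
      using that by (intro continuous_on_compose2[OF cont[of L]]) (auto intro!: continuous_intros)
    thus ?thesis by simp
  qed
  obtain x where x: "x \<in> {0..1}" "m x > 0" using m_nz m_nonneg by force
  obtain \<alpha> \<beta> m0 where ab: "0 < \<alpha>" "\<alpha> < \<beta>" "\<beta> < 1" and m0: "m0 > 0" "\<And>t. t \<in> {\<alpha>..\<beta>} \<Longrightarrow> m t \<ge> m0"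
    using positive_on_subinterval[OF m x] by metis
  \<comment> \<open>Exceeds the Riccati bound by a margin of 1, so \<open>y L\<close> cannot stay
    positive on \<open>(0, 1]\<close>.\<close>
  define L where "L = (1 / \<alpha> + 1 / (1 - \<beta>) + 1) / (m0 * (\<beta> - \<alpha>))"
  have L_eq: "L * m0 * (\<beta> - \<alpha>) = 1 / \<alpha> + 1 / (1 - \<beta>) + 1"
    using ab m0(1) by (simp add: L_def)
  have L: "L > 0" unfolding L_def using ab m0(1) by (intro divide_pos_pos add_pos_pos) auto
  obtain M where M: "M > 0" "\<And>t. t \<in> {0..1} \<Longrightarrow> \<bar>m t\<bar> \<le> M"
    using continuous_on_interval_bounded[OF m] by metis
  obtain Y where Y: "Y > 0" "\<And>l t. l \<in> {0..L} \<Longrightarrow> t \<in> {0..1} \<Longrightarrow> \<bar>y l t\<bar> \<le> Y"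
  proof -
    have "bounded ((\<lambda>(l, t). y l t) ` ({0..L} \<times> {0..1}))"
      by (intro compact_imp_bounded compact_continuous_image cont compact_Times) auto
    thus ?thesis using that unfolding bounded_pos by force
  qed
  \<comment> \<open>For \<open>0 < t \<le> t1\<close> the correction is at most
    \<open>L * M * Y * t\<^sup>2 < t\<close>, so every solution with \<open>l \<le> L\<close> is
    positive there. This separates the common zero at \<open>t = 0\<close> from the set
    \<open>Z\<close>.\<close>
  define t1 where "t1 = 1 / (L * M * Y + 1)"
  have t1: "0 < t1" "t1 \<le> 1" "L * M * Y * t1 < 1"
    using L M(1) Y(1) by (auto simp: t1_def field_simps add_pos_pos)
  have near0: "y l t > 0" if l: "l \<in> {0..L}" and t: "0 < t" "t \<le> t1" for l t
  proof -
    have t01: "t \<in> {0..1}" using t t1 by auto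
    have "\<bar>volterra (\<lambda>\<tau>. m \<tau> * y l \<tau>) t\<bar> \<le> (M * Y) * t\<^sup>2"
    proof (rule volterra_bound)
      show "continuous_on {0..1} (\<lambda>\<tau>. m \<tau> * y l \<tau>)"
        using l by (intro continuous_intros m cont_t) auto
      show "\<bar>m \<tau> * y l \<tau>\<bar> \<le> M * Y" if "\<tau> \<in> {0..1}" for \<tau>
        unfolding abs_mult using M Y l that by (intro mult_mono) auto
    qed (rule t01)
    hence "l * volterra (\<lambda>\<tau>. m \<tau> * y l \<tau>) t \<le> l * ((M * Y) * t\<^sup>2)"
      using l by (intro mult_left_mono) auto
    also have "\<dots> \<le> L * ((M * Y) * t\<^sup>2)"
      using l M(1) Y(1) by (intro mult_right_mono) auto
    also have "\<dots> = (L * M * Y * t) * t" by (simp add: power2_eq_square)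
    also have "\<dots> < 1 * t"
    proof (rule mult_strict_right_mono)
      have "L * M * Y * t \<le> L * M * Y * t1" using L M(1) Y(1) t by (intro mult_left_mono) auto
      thus "L * M * Y * t < 1" using t1 by simp
    qed (rule t)
    finally show ?thesis using eq[of l t] l t01 by simp
  qed
  have positive: "y l t > 0" if l: "l \<in> {0..L}" and nz: "\<And>s. s \<in> {t1..1} \<Longrightarrow> y l s \<noteq> 0"
    and t: "t \<in> {0<..1}" for l t
  proof (rule ccontr)
    assume "\<not> y l t > 0"
    with near0[OF l, of t] t have "t > t1" by force
    have "\<exists>s\<ge>t1. s \<le> t \<and> y l s = 0"
      using \<open>\<not> y l t > 0\<close> \<open>t > t1\<close> near0[OF l, of t1] t1 t l
      by (intro IVT2' continuous_on_subset[OF cont_t]) auto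
    with nz t show False by auto
  qed
  define Z where "Z = {z \<in> {0..L} \<times> {t1..1}. (\<lambda>(l, t). y l t) z = 0}"
  have "compact Z"
  proof -
    have "closedin (top_of_set ({0..L} \<times> {t1..1})) Z"
      unfolding Z_def
      by (intro continuous_closedin_preimage_constant continuous_on_subset[OF cont[of L]])
        (use t1 in auto)
    thus ?thesis by (rule closedin_compact[rotated]) (intro compact_Times compact_Icc)
  qed
  moreover have "Z \<noteq> {}"
  proof
    assume "Z = {}"
    hence "y L t > 0" if "t \<in> {0<..1}" for t
      using that L by (intro positive) (auto simp: Z_def)
    from positive_ivp_parameter_bound[OF m m_nonneg cont_t _ eq this ab m0(2)] L_eq L
    show False by auto
  qed
  ultimately obtain z where z: "z \<in> Z" "\<And>z'. z' \<in> Z \<Longrightarrow> fst z \<le> fst z'"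
    using continuous_attains_inf[of Z fst] continuous_on_fst[OF continuous_on_id, of Z] by blast
  define \<Lambda> where "\<Lambda> = fst z"
  define t0 where "t0 = snd z"
  have zero: "\<Lambda> \<in> {0..L}" "t0 \<in> {t1..1}" "y \<Lambda> t0 = 0"
    using z(1) by (auto simp: Z_def \<Lambda>_def t0_def)
  have below: "y l t > 0" if l: "0 \<le> l" "l < \<Lambda>" and t: "t \<in> {0<..1}" for l t
  proof (rule positive[OF _ _ t])
    show "l \<in> {0..L}" using l zero by auto
    show "y l s \<noteq> 0" if "s \<in> {t1..1}" for s
      using z(2)[of "(l, s)"] that l zero by (force simp: Z_def \<Lambda>_def)
  qed
  have "\<Lambda> > 0"
  proof (rule ccontr)
    assume "\<not> \<Lambda> > 0"
    hence "\<Lambda> = 0" using zero by auto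
    with eq[of 0 t0] zero t1 show False by auto
  qed
  \<comment> \<open>A limit, as the parameter increases to \<open>\<Lambda>\<close>, of positive
    solutions.\<close>
  have nonneg: "y \<Lambda> t \<ge> 0" if t: "t \<in> {0..1}" for t
  proof (cases "t = 0")
    case False
    have "((\<lambda>l. y l t) \<longlongrightarrow> y \<Lambda> t) (at_left \<Lambda>)"
      using continuous_on_Icc_at_leftD[OF cont_l[OF t] \<open>\<Lambda> > 0\<close>] .
    moreover have "\<forall>\<^sub>F l in at_left \<Lambda>. y l t \<ge> 0"
      unfolding eventually_at_left[OF \<open>\<Lambda> > 0\<close>]
      using below[of _ t] \<open>\<Lambda> > 0\<close> t False by (intro exI[of _ 0]) (auto intro!: less_imp_le)
    ultimately show ?thesis
      by (intro tendsto_lowerbound) auto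
  qed (use eq[of \<Lambda> 0] \<open>\<Lambda> > 0\<close> in auto)
  have eq\<Lambda>: "y \<Lambda> t = t - \<Lambda> * volterra (\<lambda>\<tau>. m \<tau> * y \<Lambda> \<tau>) t" if "t \<in> {0..1}" for t
    using eq that \<open>\<Lambda> > 0\<close> by auto
  have c\<Lambda>: "continuous_on {0..1} (y \<Lambda>)" using cont_t \<open>\<Lambda> > 0\<close> by auto
  define y1 where "y1 t = 1 - \<Lambda> * integral {0..t} (\<lambda>\<tau>. m \<tau> * y \<Lambda> \<tau>)" for t
  have D: "(y \<Lambda> has_real_derivative y1 t) (at t)"
    "(y1 has_real_derivative - \<Lambda> * m t * y \<Lambda> t) (at t)" if "t \<in> {0<..<1}" for t
    using ivp_derivatives[OF m c\<Lambda> eq\<Lambda> that] by (simp_all add: y1_def[abs_def])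
  have anti: "y1 t \<le> y1 s" if "0 \<le> s" "s \<le> t" "t \<le> 1" for s t
    unfolding y1_def using \<open>\<Lambda> > 0\<close>
    by (intro ivp_slope_antimono[OF m c\<Lambda> m_nonneg nonneg _ that]) auto
  \<comment> \<open>At an interior zero the nonnegative solution has slope 0; by concavity the slope
    before it is nonnegative, which forces \<open>y \<Lambda> s \<le> 0\<close> at some
    \<open>s \<le> t1\<close>, where the solution is positive.\<close>
  have pos: "y \<Lambda> t > 0" if t: "t \<in> {0<..<1}" for t
  proof (rule ccontr)
    assume "\<not> y \<Lambda> t > 0"
    hence yt: "y \<Lambda> t = 0" using nonneg[of t] t by auto
    have "y1 t = 0"
    proof (rule DERIV_local_min[OF D(1)[OF t]])
      show "min t (1 - t) > 0" using t by auto
      show "\<forall>s. \<bar>t - s\<bar> < min t (1 - t) \<longrightarrow> y \<Lambda> t \<le> y \<Lambda> s"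
        unfolding yt by (intro allI impI nonneg) (auto simp: abs_less_iff)
    qed
    define s where "s = min t1 t / 2"
    have s: "0 < s" "s < t" "s \<le> t1" using t t1 by (auto simp: s_def)
    obtain r where r: "r \<in> {s<..<t}" "y \<Lambda> t - y \<Lambda> s = (t - s) * y1 r"
      by (rule MVT_open[of s t "y \<Lambda>" y1]) (use s t D in \<open>auto intro!: continuous_on_subset[OF c\<Lambda>]\<close>)
    have "y1 r \<ge> 0" using anti[of r t] \<open>y1 t = 0\<close> r s t by auto
    hence "(t - s) * y1 r \<ge> 0" using s by simp
    hence "y \<Lambda> s \<le> 0" using r(2) yt by linarith
    with near0[OF zero(1) s(1,3)] show False by simp
  qed
  \<comment> \<open>The zero found in \<open>Z\<close> is therefore the right endpoint, which yields
    the second boundary condition.\<close>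
  have "t0 = 1"
    using pos[of t0] zero t1 by (cases "t0 < 1") auto
  show ?thesis
  proof (rule that[OF \<open>\<Lambda> > 0\<close> c\<Lambda> _ _ pos])
    show "y \<Lambda> 0 = 0" "y \<Lambda> 1 = 0"
      using eq\<Lambda>[of 0] zero \<open>t0 = 1\<close> by auto
    have "continuous_on {0<..<1} (\<lambda>t. - \<Lambda> * m t * y \<Lambda> t)"
      by (intro continuous_intros continuous_on_subset[OF m] continuous_on_subset[OF c\<Lambda>]) auto
    thus "C2_open01 (y \<Lambda>) (\<lambda>t. - \<Lambda> * m t * y \<Lambda> t)"
      unfolding C2_open01_def using D by blast
    show "\<exists>\<psi>. continuous_on {0..1} \<psi> \<and> (\<forall>t\<in>{0..1}. \<psi> t > 0)
        \<and> C2_open01 \<psi> (\<lambda>t. - l * m t * \<psi> t - 1)" if "0 \<le> l" "l < \<Lambda>" for l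
      by (rule positive_strict_supersolution[OF m cont_t that(1) eq below]) (use that in auto)
  qed
qed

text \<open>The positive eigenfunction shows that \<open>\<Lambda>\<close> is attained and the
  strict supersolutions exclude every smaller parameter, so \<open>LEAST\<close> over the reals
  denotes a genuine minimum.\<close>

lemma lambda1_eqI:
  assumes m_nonneg: "\<And>t. t \<in> {0..1} \<Longrightarrow> m t \<ge> 0"
    and \<phi>: "continuous_on {0..1} \<phi>" "\<phi> 0 = 0" "\<phi> 1 = 0"
      "\<And>t. t \<in> {0<..<1} \<Longrightarrow> \<phi> t > 0" "C2_open01 \<phi> (\<lambda>t. - \<Lambda> * m t * \<phi> t)"
    and super: "\<And>l. 0 \<le> l \<Longrightarrow> l < \<Lambda> \<Longrightarrow> \<exists>\<psi>. continuous_on {0..1} \<psi> \<and> (\<forall>t\<in>{0..1}. \<psi> t > 0)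
       \<and> C2_open01 \<psi> (\<lambda>t. - l * m t * \<psi> t - 1)"
  shows "lambda1 m = \<Lambda>"
  unfolding lambda1_def
proof (rule Least_equality)
  have "\<phi> (1/2) \<noteq> 0" using \<phi>(4)[of "1/2"] by simp
  hence "dirichlet_eigen m \<Lambda> \<phi>"
    unfolding dirichlet_eigen_def using \<phi> by (intro conjI bexI[of _ "1/2"] exI) auto
  thus "\<exists>u. dirichlet_eigen m \<Lambda> u" by blast
  fix l assume "\<exists>u. dirichlet_eigen m l u"
  then obtain u where u: "dirichlet_eigen m l u" ..
  show "\<Lambda> \<le> l"
  proof (rule ccontr)
    assume "\<not> \<Lambda> \<le> l"
    show False
    proof (cases "l \<ge> 0")
      case True
      with super[of l] \<open>\<not> \<Lambda> \<le> l\<close> obtain \<psi> where \<psi>: "continuous_on {0..1} \<psi>"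
        "\<And>t. t \<in> {0..1} \<Longrightarrow> \<psi> t > 0" "C2_open01 \<psi> (\<lambda>t. - l * m t * \<psi> t - 1)" by auto
      have "\<not> dirichlet_eigen m l u"
        by (rule strict_supersolution_excludes_eigenvalue[OF \<psi>]) auto
      with u show False by contradiction
    next
      case False
      have "\<not> dirichlet_eigen m l u"
      proof (rule strict_supersolution_excludes_eigenvalue)
        \<comment> \<open>For \<open>l < 0\<close> this positive, strictly concave function is a
          strict supersolution, because
          \<open>l * m t * (2 - t\<^sup>2) \<le> 0 < 2\<close>.\<close>
        show "continuous_on {0..1} (\<lambda>t::real. 2 - t\<^sup>2)" by (intro continuous_intros)
        show pos: "0 < 2 - t\<^sup>2" if "t \<in> {0..1}" for t :: real
          using that power_le_one[of t 2] by simp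
        show "C2_open01 (\<lambda>t. 2 - t\<^sup>2) (\<lambda>t. - 2)"
          unfolding C2_open01_def
          by (intro exI[of _ "\<lambda>t. - 2 * t"]) (auto intro!: derivative_eq_intros)
        show "l * m t * (2 - t\<^sup>2) < - (- 2)" if "t \<in> {0<..<1}" for t
        proof -
          have "l * m t * (2 - t\<^sup>2) \<le> 0"
            using that False m_nonneg[of t] pos[of t] by (intro mult_nonpos_nonneg) auto
          thus ?thesis by simp
        qed
      qed
      with u show False by contradiction
    qed
  qed
qed

subsection \<open>Sub- and supersolutions\<close>

lemma C2_open01_cmult:
  assumes "C2_open01 u u2"
  shows "C2_open01 (\<lambda>t. k * u t) (\<lambda>t. k * u2 t)"
proof -
  obtain u1 where "\<And>t. t \<in> {0<..<1} \<Longrightarrow> (u has_real_derivative u1 t) (at t)"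
    "\<And>t. t \<in> {0<..<1} \<Longrightarrow> (u1 has_real_derivative u2 t) (at t)" "continuous_on {0<..<1} u2"
    using assms unfolding C2_open01_def by blast
  thus ?thesis
    unfolding C2_open01_def
    by (intro exI[of _ "\<lambda>t. k * u1 t"] conjI ballI DERIV_cmult continuous_intros)
qed

text \<open>Maximum principle: a positive maximum would lie in the interior, where the second
  derivative is at most 0 and also positive.\<close>

lemma nonpos_by_strict_convexity:
  fixes w :: "real \<Rightarrow> real"
  assumes w: "continuous_on {0..1} w" "w 0 \<le> 0" "w 1 \<le> 0" "C2_open01 w w2"
    and convex: "\<And>t. t \<in> {0<..<1} \<Longrightarrow> w t > 0 \<Longrightarrow> w2 t > 0"
    and t: "t \<in> {0..1}"
  shows "w t \<le> 0"
proof (rule ccontr)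
  assume "\<not> w t \<le> 0"
  obtain x where x: "x \<in> {0..1}" "\<And>s. s \<in> {0..1} \<Longrightarrow> w s \<le> w x"
    using continuous_attains_sup[OF _ _ w(1)] by auto
  have "w x > 0" using x(2)[OF t] \<open>\<not> w t \<le> 0\<close> by simp
  have x': "x \<in> {0<..<1}"
  proof -
    have "x \<noteq> 0" "x \<noteq> 1" using \<open>w x > 0\<close> w by auto
    with x show ?thesis by auto
  qed
  obtain w1 where D: "\<And>t. t \<in> {0<..<1} \<Longrightarrow> (w has_real_derivative w1 t) (at t)"
    "\<And>t. t \<in> {0<..<1} \<Longrightarrow> (w1 has_real_derivative w2 t) (at t)"
    using w(4) unfolding C2_open01_def by blast
  have "w2 x \<le> 0"
    by (rule second_derivative_at_max[OF x' D(1) D(2)[OF x']]) (use x in auto)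
  with convex[OF x' \<open>w x > 0\<close>] show False by simp
qed

lemma C2_open01_diff:
  assumes "C2_open01 u u2" "C2_open01 v v2"
  shows "C2_open01 (\<lambda>t. u t - v t) (\<lambda>t. u2 t - v2 t)"
proof -
  obtain u1 v1 where "\<And>t. t \<in> {0<..<1} \<Longrightarrow> (u has_real_derivative u1 t) (at t)"
    "\<And>t. t \<in> {0<..<1} \<Longrightarrow> (u1 has_real_derivative u2 t) (at t)" "continuous_on {0<..<1} u2"
    "\<And>t. t \<in> {0<..<1} \<Longrightarrow> (v has_real_derivative v1 t) (at t)"
    "\<And>t. t \<in> {0<..<1} \<Longrightarrow> (v1 has_real_derivative v2 t) (at t)" "continuous_on {0<..<1} v2"
    using assms unfolding C2_open01_def by blast
  thus ?thesis
    unfolding C2_open01_def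
    by (intro exI[of _ "\<lambda>t. u1 t - v1 t"] conjI ballI DERIV_diff continuous_intros)
qed

text \<open>Clamping the argument between \<open>lo\<close> and \<open>up\<close> makes the
  right-hand side bounded and, since \<open>lo \<ge> 0\<close>, keeps it in the domain of
  \<open>H\<close>. The solution of the clamped problem is then shown to lie between the barriers,
  where nothing has been changed.\<close>

theorem sub_super_solution:
  fixes H :: "real \<Rightarrow> real \<Rightarrow> real"
  assumes H: "continuous_on ({0..1} \<times> {0..}) (\<lambda>(t, x). H t x)"
    and lo: "continuous_on {0..1} lo" "lo 0 = 0" "lo 1 = 0" "C2_open01 lo lo2"
      "\<And>t. t \<in> {0<..<1} \<Longrightarrow> - lo2 t \<le> H t (lo t)"
    and up: "continuous_on {0..1} up" "C2_open01 up up2"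
      "\<And>t. t \<in> {0<..<1} \<Longrightarrow> - up2 t \<ge> H t (up t)"
    and order: "\<And>t. t \<in> {0..1} \<Longrightarrow> 0 \<le> lo t" "\<And>t. t \<in> {0..1} \<Longrightarrow> lo t \<le> up t"
  obtains u where "continuous_on {0..1} u" "u 0 = 0" "u 1 = 0"
    "\<And>t. t \<in> {0..1} \<Longrightarrow> lo t \<le> u t" "C2_open01 u (\<lambda>t. - H t (u t))"
proof -
  define c where "c t x = max (lo t) (min (up t) x)" for t x
  \<comment> \<open>The bounded penalty makes the comparison with \<open>lo\<close> and \<open>up\<close> strict.\<close>
  define F where "F t x = H t (c t x) + max (- 1) (min 1 (c t x - x))" for t x
  have c_nonneg: "c t x \<ge> 0" if "t \<in> {0..1}" for t x
    using order(1)[OF that] by (simp add: c_def le_max_iff_disj)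
  have c_cont: "continuous_on ({0..1} \<times> UNIV) (\<lambda>z. c (fst z) (snd z))"
  proof -
    have "continuous_on ({0..1} \<times> UNIV) (\<lambda>z::real \<times> real. lo (fst z))"
      "continuous_on ({0..1} \<times> UNIV) (\<lambda>z::real \<times> real. up (fst z))"
      by (rule continuous_on_compose2[OF lo(1)] continuous_on_compose2[OF up(1)];
          auto intro!: continuous_intros)+
    thus ?thesis unfolding c_def by (intro continuous_intros)
  qed
  have F: "continuous_on ({0..1} \<times> UNIV) (\<lambda>(t, x). F t x)"
  proof -
    have "continuous_on ({0..1} \<times> UNIV) (\<lambda>z. (\<lambda>(t, x). H t x) (fst z, c (fst z) (snd z)))"
      by (rule continuous_on_compose2[OF H]) (auto intro!: continuous_intros c_cont c_nonneg)
    thus ?thesis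
      unfolding F_def case_prod_unfold by (auto intro!: continuous_intros c_cont)
  qed
  obtain B where B: "B > 0" "\<And>t. t \<in> {0..1} \<Longrightarrow> \<bar>up t\<bar> \<le> B"
    using continuous_on_interval_bounded[OF up(1)] by metis
  obtain M where M: "\<And>t x. t \<in> {0..1} \<Longrightarrow> x \<in> {0..B} \<Longrightarrow> \<bar>H t x\<bar> \<le> M"
  proof -
    have "bounded ((\<lambda>(t, x). H t x) ` ({0..1} \<times> {0..B}))"
      by (intro compact_imp_bounded compact_continuous_image continuous_on_subset[OF H] compact_Times)
        auto
    thus ?thesis using that unfolding bounded_pos by force
  qed
  have F_bound: "\<bar>F t x\<bar> \<le> M + 1" if t: "t \<in> {0..1}" for t x
  proof -
    have "c t x \<in> {0..B}"
      using c_nonneg[OF t] B(2)[OF t] order[OF t] by (auto simp: c_def)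
    from M[OF t this] show ?thesis by (auto simp: F_def)
  qed
  obtain s u where u: "continuous_on {0..1} u" "u 0 = 0" "u 1 = 0"
    and eq: "\<And>t. t \<in> {0..1} \<Longrightarrow> u t = s * t - volterra (\<lambda>\<tau>. F \<tau> (u \<tau>)) t"
    using bounded_bvp_solution[OF F F_bound] by metis
  have Fu: "continuous_on {0..1} (\<lambda>t. F t (u t))"
  proof -
    have "continuous_on {0..1} (\<lambda>t. (\<lambda>(t, x). F t x) (t, u t))"
      by (rule continuous_on_compose2[OF F]) (auto intro!: continuous_intros u)
    thus ?thesis by simp
  qed
  have C2: "C2_open01 u (\<lambda>t. - F t (u t))"
    unfolding C2_open01_def
  proof (intro exI conjI ballI)
    fix t :: real assume t: "t \<in> {0<..<1}"
    have lin: "((\<lambda>t. s * t) has_real_derivative s) (at t)" for t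
      by (auto intro!: derivative_eq_intros)
    show "(u has_real_derivative s - integral {0..t} (\<lambda>\<tau>. F \<tau> (u \<tau>))) (at t)"
      by (rule volterra_solution_C2(1)[OF Fu eq lin DERIV_const t])
    show "((\<lambda>t. s - integral {0..t} (\<lambda>\<tau>. F \<tau> (u \<tau>))) has_real_derivative - F t (u t)) (at t)"
      using volterra_solution_C2(2)[OF Fu eq lin DERIV_const t] by simp
  qed (auto intro!: continuous_intros continuous_on_subset[OF Fu])
  \<comment> \<open>Where \<open>u > up\<close>, the clamped argument is \<open>up\<close> and the
    penalty is negative, so \<open>(u - up)'' > 0\<close>. The lower barrier is symmetric.\<close>
  have le_up: "u t \<le> up t" if t: "t \<in> {0..1}" for t
  proof -
    have "u t - up t \<le> 0"
    proof (rule nonpos_by_strict_convexity[OF _ _ _ C2_open01_diff[OF C2 up(2)] _ t])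
      show "continuous_on {0..1} (\<lambda>t. u t - up t)" by (intro continuous_intros u up)
      show "u 0 - up 0 \<le> 0" "u 1 - up 1 \<le> 0" using u order[of 0] order[of 1] by auto
      fix r :: real assume r: "r \<in> {0<..<1}" "u r - up r > 0"
      hence "c r (u r) = up r" using order(2)[of r] by (auto simp: c_def)
      thus "- F r (u r) - up2 r > 0" using up(3)[OF r(1)] r(2) by (auto simp: F_def)
    qed
    thus ?thesis by simp
  qed
  have ge_lo: "lo t \<le> u t" if t: "t \<in> {0..1}" for t
  proof -
    have "lo t - u t \<le> 0"
    proof (rule nonpos_by_strict_convexity[OF _ _ _ C2_open01_diff[OF lo(4) C2] _ t])
      show "continuous_on {0..1} (\<lambda>t. lo t - u t)" by (intro continuous_intros u lo)
      show "lo 0 - u 0 \<le> 0" "lo 1 - u 1 \<le> 0" using u lo by auto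
      fix r :: real assume r: "r \<in> {0<..<1}" "lo r - u r > 0"
      hence "c r (u r) = lo r" using order(2)[of r] by (auto simp: c_def)
      thus "lo2 r - (- F r (u r)) > 0" using lo(5)[OF r(1)] r(2) by (auto simp: F_def)
    qed
    thus ?thesis by simp
  qed
  have FH: "F t (u t) = H t (u t)" if "t \<in> {0..1}" for t
    using le_up[OF that] ge_lo[OF that] by (simp add: F_def c_def)
  hence "continuous_on {0<..<1} (\<lambda>t. - F t (u t)) \<longleftrightarrow> continuous_on {0<..<1} (\<lambda>t. - H t (u t))"
    by (intro continuous_on_cong) auto
  with C2 FH have "C2_open01 u (\<lambda>t. - H t (u t))"
    unfolding C2_open01_def by auto
  with that u ge_lo show ?thesis by blast
qed

section \<open>The change of variables from the annulus to the unit interval\<close>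

definition annulus_radius :: "nat \<Rightarrow> real \<Rightarrow> real \<Rightarrow> real \<Rightarrow> real" where
  "annulus_radius N r1 r2 t = ffun N r1 r2 (\<lambda>r _. r) t 0"

text \<open>The radius at which \<open>ffun\<close> evaluates \<open>h\<close> does not depend on
  \<open>h\<close>, so it can be read off by inserting the projection to the first argument. Both
  cases of \<open>N\<close> are then handled at once.\<close>

lemma ffun_eq: "ffun N r1 r2 h t u = h (annulus_radius N r1 r2 t) u"
  by (simp add: annulus_radius_def ffun_def Let_def)

lemma annulus_transformation:
  assumes r: "0 < r1" "r1 < r2" and N: "N \<ge> 2"
  shows "continuous_on {0..1} (annulus_radius N r1 r2)"
    and "t \<in> {0..1} \<Longrightarrow> annulus_radius N r1 r2 t \<in> {r1..r2}"
    and "continuous_on {0..1} (qfun N r1 r2)"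
    and "t \<in> {0..1} \<Longrightarrow> qfun N r1 r2 t > 0"
proof -
  have "continuous_on {0..1} (annulus_radius N r1 r2) \<and>
    (\<forall>t\<in>{0..1}. annulus_radius N r1 r2 t \<in> {r1..r2}) \<and>
    continuous_on {0..1} (qfun N r1 r2) \<and> (\<forall>t\<in>{0..1}. qfun N r1 r2 t > 0)"
  proof (cases "N = 2")
    case True
    have eqs: "annulus_radius N r1 r2 = (\<lambda>t. r2 * (r1 / r2) powr t)"
      "qfun N r1 r2 = (\<lambda>t. (r2 * (r1 / r2) powr t * ln (r2 / r1))\<^sup>2)"
      using True by (auto simp: annulus_radius_def ffun_def qfun_def)
    have "r2 * (r1 / r2) powr t \<in> {r1..r2}" if "t \<in> {0..1}" for t
    proof -
      \<comment> \<open>The base is below 1, so the power decreases in \<open>t\<close>, from radius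
        \<open>r2\<close> at 0 to \<open>r1\<close> at 1.\<close>
      have "(r1 / r2) powr 1 \<le> (r1 / r2) powr t" "(r1 / r2) powr t \<le> (r1 / r2) powr 0"
        using that r by (intro powr_mono'; simp)+
      thus ?thesis using r by (simp add: field_simps)
    qed
    moreover have "ln (r2 / r1) > 0" using r by simp
    ultimately show ?thesis
      unfolding eqs using r by (auto intro!: continuous_intros)
  next
    case False
    define k where "k = N - 2"
    have k: "k > 0" "real N - 2 = real k" using False N by (auto simp: k_def)
    define A where "A = (r1 * r2) ^ k / (r2 ^ k - r1 ^ k)"
    define B where "B = r2 ^ k / (r2 ^ k - r1 ^ k)"
    have lt: "r1 ^ k < r2 ^ k" using r k by (intro power_strict_mono) auto
    have A: "A > 0" using r lt by (simp add: A_def)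
    have eqs: "annulus_radius N r1 r2 = (\<lambda>t. (A / (B - t)) powr (1 / real k))"
      "qfun N r1 r2 = (\<lambda>t. (1 / (real k)\<^sup>2) * A powr (2 / real k)
         / (B - t) powr (2 * (real N - 1) / real k))"
      using False
      by (auto simp: annulus_radius_def ffun_def qfun_def Let_def A_def B_def k_def[symmetric] k(2))
    have B: "B - t > 0" "A / (B - t) \<in> {r1 ^ k..r2 ^ k}" if t: "t \<in> {0..1}" for t
    proof -
      \<comment> \<open>In terms of \<open>w\<close>, which ranges over
        \<open>[0, r2 ^ k - r1 ^ k]\<close>, the quotient \<open>A / (B - t)\<close> becomes
        \<open>r1 ^ k * r2 ^ k / (r2 ^ k - w)\<close>, whose extreme values are
        \<open>r1 ^ k\<close> and \<open>r2 ^ k\<close>.\<close>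
      define w where "w = t * (r2 ^ k - r1 ^ k)"
      have Bt: "B - t = (r2 ^ k - w) / (r2 ^ k - r1 ^ k)"
        using lt by (simp add: B_def w_def field_simps)
      have le: "w \<le> r2 ^ k - r1 ^ k" "0 \<le> w"
        using t lt mult_right_mono[of t 1 "r2 ^ k - r1 ^ k"] by (auto simp: w_def)
      have p: "r1 ^ k > 0" "r2 ^ k > 0" using r by auto
      have pos: "r2 ^ k - w > 0" using le p by linarith
      show "B - t > 0" unfolding Bt using pos lt by simp
      have "A / (B - t) = r1 ^ k * r2 ^ k / (r2 ^ k - w)"
        unfolding Bt using lt by (simp add: A_def power_mult_distrib)
      moreover have "r1 ^ k * (r2 ^ k - w) \<le> r1 ^ k * r2 ^ k"
        using le p by (intro mult_left_mono) auto
      moreover have "r1 ^ k * r2 ^ k \<le> (r2 ^ k - w) * r2 ^ k"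
        using le p by (intro mult_right_mono) auto
      ultimately show "A / (B - t) \<in> {r1 ^ k..r2 ^ k}"
        using pos by (simp add: pos_le_divide_eq pos_divide_le_eq mult_ac)
    qed
    have "(A / (B - t)) powr (1 / real k) \<in> {r1..r2}" if t: "t \<in> {0..1}" for t
    proof -
      have root: "(x ^ k) powr (1 / real k) = x" if "x > 0" for x :: real
        using that k by (simp add: powr_realpow[symmetric] powr_powr)
      have p: "r1 ^ k > 0" using r by auto
      have "(r1 ^ k) powr (1 / real k) \<le> (A / (B - t)) powr (1 / real k)"
        "(A / (B - t)) powr (1 / real k) \<le> (r2 ^ k) powr (1 / real k)"
        using B[OF t] p A by (intro powr_mono2; simp)+
      thus ?thesis using root[of r1] root[of r2] r by simp
    qed
    moreover have "continuous_on {0..1} (\<lambda>t. (A / (B - t)) powr (1 / real k))"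
      using B(1) A by (intro continuous_intros) force+
    moreover have "continuous_on {0..1} (\<lambda>t. (1 / (real k)\<^sup>2) * A powr (2 / real k)
         / (B - t) powr (2 * (real N - 1) / real k))"
      using B(1) A by (intro continuous_intros) force+
    moreover have "(1 / (real k)\<^sup>2) * A powr (2 / real k)
         / (B - t) powr (2 * (real N - 1) / real k) > 0" if "t \<in> {0..1}" for t
      using B(1)[OF that] A k by simp
    ultimately show ?thesis unfolding eqs by blast
  qed
  thus "continuous_on {0..1} (annulus_radius N r1 r2)"
    and "t \<in> {0..1} \<Longrightarrow> annulus_radius N r1 r2 t \<in> {r1..r2}"
    and "continuous_on {0..1} (qfun N r1 r2)"
    and "t \<in> {0..1} \<Longrightarrow> qfun N r1 r2 t > 0" by blast+
qed

section \<open>Ordered barriers for the nonlinear problem and the positive solution between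
  them\<close>

theorem theorem1p6:
  fixes N :: nat and r1 r2 c \<delta> R lam :: real
    and h :: "real \<Rightarrow> real \<Rightarrow> real" and b :: "real \<Rightarrow> real"
  assumes "0 < r1" "r1 < r2" "N \<ge> 2"
    and "continuous_on ({r1..r2} \<times> {0..}) (\<lambda>(t, u). h t u)"
    and "\<And>t u. t \<in> {r1..r2} \<Longrightarrow> u \<ge> 0 \<Longrightarrow> h t u \<ge> 0"
    and "\<And>t. t \<in> {r1..r2} \<Longrightarrow> h t 0 = 0"
    and "continuous_on {0..1} b" "\<And>t. t \<in> {0..1} \<Longrightarrow> b t \<ge> 0"
    and "\<exists>t\<in>{0..1}. b t \<noteq> 0"
    and "c > 1" "0 < \<delta>" "\<delta> < R"
    and "\<And>t u. t \<in> {0<..<1} \<Longrightarrow> u \<ge> R \<Longrightarrow> ffun N r1 r2 h t u \<le> b t * u"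
    and "\<And>t u. t \<in> {0<..<1} \<Longrightarrow> 0 < u \<Longrightarrow> u < \<delta> \<Longrightarrow> ffun N r1 r2 h t u \<ge> c * b t * u"
    and "lambda1 (\<lambda>t. qfun N r1 r2 t * b t) / c < lam"
    and "lam < lambda1 (\<lambda>t. qfun N r1 r2 t * b t)"
  shows "\<exists>u. positive_solution N r1 r2 h lam u"
proof -
  define q where "q = qfun N r1 r2"
  define f where "f = ffun N r1 r2 h"
  define m where "m = (\<lambda>t. q t * b t)"
  note transf = annulus_transformation[OF assms(1-3)]
  have q: "continuous_on {0..1} q" "\<And>t. t \<in> {0..1} \<Longrightarrow> q t > 0"
    using transf(3,4) by (auto simp: q_def)
  have f: "continuous_on ({0..1} \<times> {0..}) (\<lambda>(t, u). f t u)"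
  proof -
    have "continuous_on ({0..1} \<times> {0..}) (\<lambda>z::real \<times> real. annulus_radius N r1 r2 (fst z))"
      by (rule continuous_on_compose2[OF transf(1)]) (auto intro!: continuous_intros)
    hence "continuous_on ({0..1} \<times> {0..})
        (\<lambda>z. (\<lambda>(t, u). h t u) (annulus_radius N r1 r2 (fst z), snd z))"
      using transf(2) by (intro continuous_on_compose2[OF assms(4)]) (auto intro!: continuous_intros)
    thus ?thesis by (simp add: f_def ffun_eq[abs_def] case_prod_unfold)
  qed
  have f_large: "f t u \<le> b t * u" if "t \<in> {0<..<1}" "u \<ge> R" for t u
    using assms(13) that by (simp add: f_def)
  have f_small: "f t u \<ge> c * b t * u" if "t \<in> {0<..<1}" "0 < u" "u < \<delta>" for t u
    using assms(14) that by (simp add: f_def)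
  have m: "continuous_on {0..1} m" "\<And>t. t \<in> {0..1} \<Longrightarrow> m t \<ge> 0" "\<exists>t\<in>{0..1}. m t \<noteq> 0"
    using q assms(7-9) by (auto simp: m_def less_imp_le intro!: continuous_intros) force
  obtain \<Lambda> \<phi> where \<Lambda>: "\<Lambda> > 0"
    and \<phi>: "continuous_on {0..1} \<phi>" "\<phi> 0 = 0" "\<phi> 1 = 0"
      "\<And>t. t \<in> {0<..<1} \<Longrightarrow> \<phi> t > 0" "C2_open01 \<phi> (\<lambda>t. - \<Lambda> * m t * \<phi> t)"
    and super: "\<And>l. 0 \<le> l \<Longrightarrow> l < \<Lambda> \<Longrightarrow> \<exists>\<psi>. continuous_on {0..1} \<psi> \<and> (\<forall>t\<in>{0..1}. \<psi> t > 0)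
       \<and> C2_open01 \<psi> (\<lambda>t. - l * m t * \<psi> t - 1)"
    using principal_eigenpair[OF m] by blast
  have "lambda1 m = \<Lambda>" by (rule lambda1_eqI[OF m(2) \<phi> super])
  hence lam: "\<Lambda> / c < lam" "lam < \<Lambda>" using assms(15,16) by (auto simp: m_def q_def)
  have "lam > 0" using lam(1) \<Lambda> assms(10) by (smt (verit) divide_pos_pos)
  have lam_c: "\<Lambda> < lam * c" using lam(1) assms(10) by (simp add: field_simps)
  obtain \<psi> where \<psi>: "continuous_on {0..1} \<psi>" "\<And>t. t \<in> {0..1} \<Longrightarrow> \<psi> t > 0"
    "C2_open01 \<psi> (\<lambda>t. - lam * m t * \<psi> t - 1)"
    using super[of lam] \<open>lam > 0\<close> lam(2) by auto
  obtain p where p: "p > 0" "\<And>t. t \<in> {0..1} \<Longrightarrow> p \<le> \<psi> t"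
  proof -
    obtain x where "x \<in> {0..1}" "\<forall>t\<in>{0..1}. \<psi> x \<le> \<psi> t"
      using continuous_attains_inf[OF _ _ \<psi>(1)] by auto
    with \<psi>(2)[of x] that[of "\<psi> x"] show ?thesis by blast
  qed
  obtain Q where Q: "Q > 0" "\<And>t. t \<in> {0..1} \<Longrightarrow> \<bar>q t\<bar> \<le> Q"
    using continuous_on_interval_bounded[OF q(1)] by metis
  obtain P where P: "P > 0" "\<And>t. t \<in> {0..1} \<Longrightarrow> \<bar>\<phi> t\<bar> \<le> P"
    using continuous_on_interval_bounded[OF \<phi>(1)] by metis
  obtain M where M: "M > 0" "\<And>t u. t \<in> {0..1} \<Longrightarrow> u \<in> {0..R} \<Longrightarrow> \<bar>f t u\<bar> \<le> M"
  proof -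
    have "bounded ((\<lambda>(t, u). f t u) ` ({0..1} \<times> {0..R}))"
      by (intro compact_imp_bounded compact_continuous_image continuous_on_subset[OF f] compact_Times)
        auto
    thus ?thesis using that unfolding bounded_pos by force
  qed
  \<comment> \<open>Above \<open>R\<close> this is the growth condition; below \<open>R\<close> the
    compactness bound \<open>M\<close> takes over, as \<open>b t * u \<ge> 0\<close>.\<close>
  have f_le: "f t u \<le> b t * u + M" if "t \<in> {0<..<1}" "u \<ge> 0" for t u
  proof (cases "u \<ge> R")
    case True
    thus ?thesis using f_large[of t u] that M(1) by simp
  next
    case False
    hence "f t u \<le> M" using M(2)[of t u] that by auto
    moreover have "b t * u \<ge> 0" using assms(8)[of t] that by simp
    ultimately show ?thesis by simp
  qed
  \<comment> \<open>\<open>K * \<psi>\<close> satisfies the linear equation with forcing term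
    \<open>K\<close>, which is chosen to absorb the error \<open>lam * q t * M\<close> coming from
    \<open>f_le\<close>.\<close>
  define K where "K = lam * (Q * M)"
  have K: "K > 0" using \<open>lam > 0\<close> Q(1) M(1) by (simp add: K_def)
  \<comment> \<open>The bound \<open>\<delta> / 2\<close> keeps \<open>\<epsilon> * \<phi>\<close>
    in the range of the condition near zero; the bound \<open>K * p\<close> places it below
    \<open>K * \<psi>\<close>.\<close>
  define \<epsilon> where "\<epsilon> = min (\<delta> / 2) (K * p) / P"
  have \<epsilon>: "\<epsilon> > 0" using assms(11) K p(1) P(1) by (simp add: \<epsilon>_def)
  have \<epsilon>\<phi>: "\<epsilon> * \<phi> t \<le> \<delta> / 2" "\<epsilon> * \<phi> t \<le> K * p" if "t \<in> {0..1}" for t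
  proof -
    have "\<epsilon> * \<phi> t \<le> \<epsilon> * P" using P(2)[OF that] \<epsilon> by (intro mult_left_mono) auto
    also have "\<epsilon> * P = min (\<delta> / 2) (K * p)" using P(1) by (simp add: \<epsilon>_def)
    finally show "\<epsilon> * \<phi> t \<le> \<delta> / 2" "\<epsilon> * \<phi> t \<le> K * p" by auto
  qed
  define H where "H t u = lam * q t * f t u" for t u
  have H: "continuous_on ({0..1} \<times> {0..}) (\<lambda>(t, u). H t u)"
  proof -
    have "continuous_on ({0..1} \<times> {0..}) (\<lambda>z::real \<times> real. q (fst z))"
      by (rule continuous_on_compose2[OF q(1)]) (auto intro!: continuous_intros)
    with f show ?thesis
      unfolding H_def case_prod_unfold by (intro continuous_intros)
  qed
  have sub: "- (\<epsilon> * (- \<Lambda> * m t * \<phi> t)) \<le> H t (\<epsilon> * \<phi> t)" if t: "t \<in> {0<..<1}" for t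
  proof -
    have t': "t \<in> {0..1}" using t by auto
    have "- (\<epsilon> * (- \<Lambda> * m t * \<phi> t)) = \<Lambda> * (m t * (\<epsilon> * \<phi> t))" by simp
    also have "\<dots> \<le> (lam * c) * (m t * (\<epsilon> * \<phi> t))"
      using lam_c m(2)[OF t'] \<phi>(4)[OF t] \<epsilon> by (intro mult_right_mono mult_nonneg_nonneg) auto
    also have "\<dots> = lam * q t * (c * b t * (\<epsilon> * \<phi> t))" by (simp add: m_def)
    also have "\<dots> \<le> lam * q t * f t (\<epsilon> * \<phi> t)"
      using \<open>lam > 0\<close> q(2)[OF t'] \<phi>(4)[OF t] \<epsilon> \<epsilon>\<phi>(1)[OF t'] assms(11)
      by (intro mult_left_mono f_small t) auto
    finally show ?thesis by (simp add: H_def)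
  qed
  have sup: "- (K * (- lam * m t * \<psi> t - 1)) \<ge> H t (K * \<psi> t)" if t: "t \<in> {0<..<1}" for t
  proof -
    have t': "t \<in> {0..1}" using t by auto
    have "H t (K * \<psi> t) \<le> lam * q t * (b t * (K * \<psi> t) + M)"
      unfolding H_def using \<open>lam > 0\<close> q(2)[OF t'] K \<psi>(2)[OF t']
      by (intro mult_left_mono f_le t) auto
    also have "\<dots> = lam * m t * (K * \<psi> t) + lam * (q t * M)"
      by (simp add: m_def algebra_simps)
    also have "lam * (q t * M) \<le> K"
      unfolding K_def using \<open>lam > 0\<close> Q(2)[OF t'] M(1) by (intro mult_left_mono mult_right_mono) auto
    finally show ?thesis by (simp add: algebra_simps)
  qed
  obtain u where u: "continuous_on {0..1} u" "u 0 = 0" "u 1 = 0"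
    "\<And>t. t \<in> {0..1} \<Longrightarrow> \<epsilon> * \<phi> t \<le> u t" "C2_open01 u (\<lambda>t. - H t (u t))"
  proof (rule sub_super_solution[OF H _ _ _ C2_open01_cmult[OF \<phi>(5)] sub _ C2_open01_cmult[OF \<psi>(3)] sup])
    show "continuous_on {0..1} (\<lambda>t. \<epsilon> * \<phi> t)" "continuous_on {0..1} (\<lambda>t. K * \<psi> t)"
      by (intro continuous_intros \<phi> \<psi>)+
    show "0 \<le> \<epsilon> * \<phi> t" if "t \<in> {0..1}" for t
    proof -
      have "\<phi> t \<ge> 0" using that \<phi>(2,3) \<phi>(4)[of t] by (cases "t = 0 \<or> t = 1") auto
      thus ?thesis using \<epsilon> by simp
    qed
    show "\<epsilon> * \<phi> t \<le> K * \<psi> t" if "t \<in> {0..1}" for t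
      using \<epsilon>\<phi>(2)[OF that] p(2)[OF that] K by (meson mult_le_cancel_left_pos order_trans)
  qed (use \<phi> in auto)
  \<comment> \<open>Lying above the positive subsolution separates \<open>u\<close> from the trivial
    solution 0.\<close>
  have "u t > 0" if "t \<in> {0<..<1}" for t
  proof -
    have "0 < \<epsilon> * \<phi> t" using \<epsilon> \<phi>(4)[OF that] by simp
    also have "\<dots> \<le> u t" using that by (intro u) auto
    finally show ?thesis .
  qed
  with u have "positive_solution N r1 r2 h lam u"
    unfolding positive_solution_def by (auto simp: H_def q_def f_def intro!: exI[of _ "\<lambda>t. - H t (u t)"])
  thus ?thesis by blast
qed

end
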